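(* Let $4\le p\le n-1$, let $\langle R,S,T\rangle$ be a partition of $V$ (some parts possibly empty) with $0,n\in S$. The generalized max-cut inequality $$x((S:T))+\sum_{i\in R}x(\delta^+(i))\le \left\lfloor \tfrac{p+|R|}{2}\right\rfloor$$ is valid for $P^p_{0,n}(D)$, and it is facet defining for $P^p_{0,n}(D)$ if and only if $p+|R|$ is odd, $|S\setminus\{n\}|>(p-|R|)/2$, $|T|>(p-|R|)/2$, and either (i) $p=|R|+3$, $|R|\ge 2$ and $|S|=3$, or (ii) $p\ge |R|+5$.
   Context: Let $n$ be a positive integer, $V=\{0,1,\dots,n\}$, and let $D=(V,A)$ be the digraph whose arc set $A$ consists of all ordered pairs $(i,j)$ with $i\neq j$, $i,j\in V$, except that no arc enters node $0$, no arc leaves node $n$, and the arc $(0,n)$ is absent. A $(0,n)$-$p$-path is a simple directed path in $D$ from $0$ to $n$ with exactly $p$ arcs. $P^p_{0,n}(D)\subseteq\mathbb{R}^A$ is the convex hull of the incidence vectors of all $(0,n)$-$p$-paths. For $F\subseteq A$, $x(F)=\sum_{(i,j)\in F}x_{ij}$; $\delta^+(k)$ is the set of arcs of $A$ leaving node $k$. For node sets $S,T$, $(S:T)=\{(i,j)\in A: i\in S, j\in T\}$. Facet defining means valid and defining a face of dimension $\dim P^p_{0,n}(D)-1$. *)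

theory Defs
  imports "HOL-Analysis.Analysis" "HOL-Library.Function_Algebras"
begin

text \<open>Real-valued functions on an arbitrary index type form a real vector space
(pointwise operations).  This lets us use the library notions convex hull and
affine (in)dependence for points of R^A, represented as functions on arcs.\<close>

instantiation "fun" :: (type, real_vector) real_vector
begin
definition scaleR_fun :: "real \<Rightarrow> ('a \<Rightarrow> 'b) \<Rightarrow> 'a \<Rightarrow> 'b"
  where "scaleR_fun r f = (\<lambda>x. r *\<^sub>R f x)"
instance
  by standard (auto simp: scaleR_fun_def fun_eq_iff plus_fun_def fun_diff_def fun_Compl_def zero_fun_def scaleR_add_right scaleR_add_left algebra_simps)
end

type_synonym arc = "nat \<times> nat"

definition arcs :: "nat \<Rightarrow> arc set" where
  "arcs n = {(i, j). i \<in> {0..n} \<and> j \<in> {0..n} \<and> i \<noteq> j \<and> j \<noteq> 0 \<and> i \<noteq> n \<and> (i, j) \<noteq> (0, n)}"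

definition is_p_path :: "nat \<Rightarrow> nat \<Rightarrow> nat list \<Rightarrow> bool" where
  "is_p_path n p vs \<longleftrightarrow> length vs = p + 1 \<and> distinct vs \<and> hd vs = 0 \<and> last vs = n \<and>
     (\<forall>i < p. (vs ! i, vs ! (i + 1)) \<in> arcs n)"

definition path_arcs :: "nat list \<Rightarrow> arc set" where
  "path_arcs vs = set (zip vs (tl vs))"

definition incidence :: "nat list \<Rightarrow> arc \<Rightarrow> real" where
  "incidence vs = (\<lambda>e. if e \<in> path_arcs vs then 1 else 0)"

definition path_polytope :: "nat \<Rightarrow> nat \<Rightarrow> (arc \<Rightarrow> real) set" where
  "path_polytope n p = convex hull {incidence vs | vs. is_p_path n p vs}"

definition pdim :: "(arc \<Rightarrow> real) set \<Rightarrow> int" where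
  "pdim P = (if P = {} then -1 else
     int (GREATEST k. \<exists>Y. Y \<subseteq> P \<and> finite Y \<and> \<not> affine_dependent Y \<and> card Y = Suc k))"

definition xsum :: "(arc \<Rightarrow> real) \<Rightarrow> arc set \<Rightarrow> real" where
  "xsum x F = (\<Sum>e\<in>F. x e)"

definition delta_plus :: "nat \<Rightarrow> nat \<Rightarrow> arc set" where
  "delta_plus n k = {(i, j) \<in> arcs n. i = k}"

definition arcs_between :: "nat \<Rightarrow> nat set \<Rightarrow> nat set \<Rightarrow> arc set" where
  "arcs_between n S T = {(i, j) \<in> arcs n. i \<in> S \<and> j \<in> T}"

definition valid_ineq :: "(arc \<Rightarrow> real) set \<Rightarrow> ((arc \<Rightarrow> real) \<Rightarrow> real) \<Rightarrow> real \<Rightarrow> bool" where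
  "valid_ineq P f b \<longleftrightarrow> (\<forall>x\<in>P. f x \<le> b)"

definition facet_defining :: "(arc \<Rightarrow> real) set \<Rightarrow> ((arc \<Rightarrow> real) \<Rightarrow> real) \<Rightarrow> real \<Rightarrow> bool" where
  "facet_defining P f b \<longleftrightarrow> valid_ineq P f b \<and> pdim {x \<in> P. f x = b} = pdim P - 1"

definition gmc_lhs :: "nat \<Rightarrow> nat set \<Rightarrow> nat set \<Rightarrow> nat set \<Rightarrow> (arc \<Rightarrow> real) \<Rightarrow> real" where
  "gmc_lhs n R S T x = xsum x (arcs_between n S T) + (\<Sum>i\<in>R. xsum x (delta_plus n i))"

end

theory Submission
  imports Defs
begin

text \<open>
  Give an arc the weight \<open>w\<close> of its coefficient in the inequality. A path with \<open>\<rho>\<close>, \<open>\<sigma>\<close>, \<open>\<tau>\<close> inner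
  nodes in \<open>R\<close>, \<open>S\<close>, \<open>T\<close> has weight at most \<open>\<rho> + \<sigma> + 1\<close> (arcs leaving \<open>S\<close>) and at most \<open>\<rho> + \<tau>\<close>
  (arcs entering \<open>T\<close>); adding both gives validity and shows how little slack a tight path has.

  Every vertex of the polytope lies in a hyperplane avoiding the origin, so the face is a facet iff
  the linear functionals constant on the tight paths are spanned, on all paths, by the constants
  and \<open>w\<close>. If one of the conditions fails, a second equation holds on the face: mostly two arcs are
  used by no tight path. If the conditions hold, a functional constant on the tight paths is first
  normalized by node potentials; comparing tight paths that differ by exchanging or moving few
  nodes then determines all its coefficients up to one factor.
\<close>

section \<open>Faces of polytopes and dimension\<close>

text \<open>For a path of weight W let a be the number of its arcs that leave S without entering T,
  c the number of those that enter T without leaving S, and r the number of nodes of R that it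
  misses. The two bounds of the overview are off by exactly a and c, so r + a + c = p + |R| - 2W.
  Hence tight paths have no slack if p + |R| is even and exactly one unit of it if p + |R| is odd.
  In the odd case write p = |R| + 2k + 1; the right-hand side is |R| + k. Spending the unit as a = 1
  needs k inner nodes in S and k in T, as c = 1 it needs k - 1 and k + 1, as r = 1 it needs k and k
  + 1. So the two cardinality conditions, k inner nodes in S and k + 1 nodes in T, make all these
  counts possible; if one fails, the place of the slack is forced and other arcs disappear. The
  value k = 1 is exceptional: a tight path then meets at most one inner node of S, and if also |R| =
  1, an extra equation holds that comes from no missing arc.\<close>

lemma affine_dependent_iff_dependent:
  fixes h :: "'a::real_vector \<Rightarrow> real"
  assumes "finite Y" "linear h" "\<And>y. y \<in> Y \<Longrightarrow> h y = 1"
  shows "affine_dependent Y \<longleftrightarrow> dependent Y"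
proof -
  have *: "sum u Y = 0" if "(\<Sum>v\<in>Y. u v *\<^sub>R v) = 0" for u
  proof -
    have "0 = h (\<Sum>v\<in>Y. u v *\<^sub>R v)"
      using that assms(2) by (simp add: linear_0)
    also have "\<dots> = (\<Sum>v\<in>Y. u v * h v)"
      using assms(2) by (simp add: linear_sum linear_cmul)
    also have "\<dots> = sum u Y"
      using assms(3) by (intro sum.cong) auto
    finally show ?thesis by simp
  qed
  show ?thesis
    unfolding affine_dependent_explicit_finite[OF assms(1)] real_vector.dependent_finite[OF assms(1)]
    using * by blast
qed

lemma linear_const_on_hull:
  fixes h :: "'a::real_vector \<Rightarrow> real"
  assumes "linear h" "\<And>y. y \<in> X \<Longrightarrow> h y = a" "y \<in> convex hull X"
  shows "h y = a"
proof -
  have "convex (h -` {a})"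
    using assms(1) by (intro convex_linear_vimage) auto
  then have "convex hull X \<subseteq> h -` {a}"
    using assms(2) by (intro hull_minimal) auto
  then show ?thesis using assms(3) by auto
qed

text \<open>Applying \<open>h\<close> to a linear relation among points with \<open>h = 1\<close>
  shows that its coefficients sum to 0, so linear and affine dependence agree there. A largest
  affinely independent family has \<open>dim X\<close> points, one more than the dimension; for
  empty \<open>X\<close> both sides are -1.\<close>

lemma pdim_convex_hull:
  fixes h :: "(arc \<Rightarrow> real) \<Rightarrow> real"
  assumes "finite X" "linear h" "\<And>x. x \<in> X \<Longrightarrow> h x = 1"
  shows "pdim (convex hull X) = int (dim X) - 1"
proof (cases "X = {}")
  case True
  then show ?thesis
    by (simp add: pdim_def real_vector.dim_eq_card_independent real_vector.independent_empty)
next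
  case False
  define Q where "Q k \<longleftrightarrow> (\<exists>Y. Y \<subseteq> convex hull X \<and> finite Y \<and> \<not> affine_dependent Y \<and> card Y = Suc k)" for k
  have indep: "affine_dependent Y \<longleftrightarrow> dependent Y" if "Y \<subseteq> convex hull X" "finite Y" for Y
    using that linear_const_on_hull[OF assms(2), of X 1] assms(2,3)
    by (intro affine_dependent_iff_dependent[of _ h]) auto
  obtain B where B: "B \<subseteq> X" "independent B" "X \<subseteq> span B" "card B = dim X"
    using real_vector.basis_exists by blast
  have finB: "finite B" using B(1) assms(1) finite_subset by blast
  have "B \<noteq> {}"
  proof
    assume "B = {}"
    with B(3) False have "X = {0}" by auto
    with assms(3)[of 0] assms(2) show False by (simp add: linear_0)
  qed
  with finB have pos: "dim X > 0" using B(4) by (metis card_gt_0_iff)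
  have "Q (dim X - 1)"
    unfolding Q_def using B finB pos indep[of B] hull_subset[of X convex]
    by (intro exI[of _ B]) auto
  moreover have "k \<le> dim X - 1" if Qk: "Q k" for k
  proof -
    obtain Y where Y: "Y \<subseteq> convex hull X" "finite Y" "\<not> affine_dependent Y" "card Y = Suc k"
      using Qk unfolding Q_def by blast
    have "convex hull X \<subseteq> span X"
      by (rule hull_minimal) (auto intro: real_vector.span_base subspace_imp_convex)
    also have "\<dots> \<subseteq> span B"
      using B(3) by (simp add: real_vector.span_minimal)
    finally have "Y \<subseteq> span B" using Y(1) by (rule order_trans[rotated])
    moreover have "independent Y" using indep[of Y] Y by simp
    ultimately have "card Y \<le> card B"
      using real_vector.independent_span_bound[OF finB] by simp
    then show ?thesis using Y(4) B(4) by simp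
  qed
  ultimately have "Greatest Q = dim X - 1"
    by (intro Greatest_equality)
  then show ?thesis
    using False pos unfolding pdim_def Q_def by simp
qed

text \<open>In a convex combination of value \<open>b\<close> the gaps \<open>b - f y\<close> are
  nonnegative with weighted sum 0, so all weight lies on points that attain
  \<open>b\<close>.\<close>

lemma face_of_convex_hull:
  fixes f :: "'a::real_vector \<Rightarrow> real"
  assumes "finite X" "linear f" and le: "\<And>x. x \<in> X \<Longrightarrow> f x \<le> b"
  shows "{x \<in> convex hull X. f x = b} = convex hull {x \<in> X. f x = b}" (is "_ = convex hull ?F")
proof (intro equalityI subsetI)
  fix x assume "x \<in> convex hull ?F"
  then show "x \<in> {x \<in> convex hull X. f x = b}"
    using linear_const_on_hull[OF assms(2), of ?F b x] hull_mono[of ?F X] by auto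
next
  fix x assume x: "x \<in> {x \<in> convex hull X. f x = b}"
  then obtain u where u: "\<And>y. y \<in> X \<Longrightarrow> 0 \<le> u y" "sum u X = 1" "(\<Sum>y\<in>X. u y *\<^sub>R y) = x"
    unfolding convex_hull_finite[OF assms(1)] by auto
  have "f x = (\<Sum>y\<in>X. u y * f y)"
    using assms(2) u(3) by (auto simp: linear_sum linear_cmul)
  then have "(\<Sum>y\<in>X. u y * (b - f y)) = 0"
    using x u(2) by (simp add: right_diff_distrib sum_subtractf sum_distrib_right[symmetric])
  then have "\<forall>y\<in>X. u y * (b - f y) = 0"
    using u(1) le assms(1) by (subst (asm) sum_nonneg_eq_0_iff) auto
  then have 0: "u y = 0" if "y \<in> X - ?F" for y using that by auto
  have "(\<Sum>y\<in>?F. u y *\<^sub>R y) = x" "sum u ?F = 1"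
    using u(2,3) 0 assms(1) sum.mono_neutral_left[of X ?F "\<lambda>y. u y *\<^sub>R y"] sum.mono_neutral_left[of X ?F u]
    by auto
  then show "x \<in> convex hull ?F"
    using u(1) assms(1) by (subst convex_hull_finite) (auto intro!: exI[of _ u])
qed

lemma dim_insert_notin_span:
  fixes x :: "'a::real_vector"
  assumes "finite F" "x \<notin> span F"
  shows "dim (insert x F) = dim F + 1"
proof -
  obtain B where B: "B \<subseteq> F" "independent B" "F \<subseteq> span B" "card B = dim F"
    using real_vector.basis_exists by blast
  have fin: "finite B" using B(1) assms(1) finite_subset by blast
  have "x \<notin> span B" using assms(2) real_vector.span_mono[OF B(1)] by blast
  moreover have "x \<notin> B" using assms(2) B(1) real_vector.span_base by blast
  moreover have "insert x F \<subseteq> span (insert x B)"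
    using B(3) real_vector.span_mono[of B "insert x B"] by (auto intro: real_vector.span_base)
  ultimately show ?thesis
    using B fin by (intro real_vector.dim_unique[of "insert x B"]) (auto simp: real_vector.independent_insert)
qed

lemma facet_defining_convex_hull_iff:
  fixes h :: "(arc \<Rightarrow> real) \<Rightarrow> real"
  assumes "finite X" "linear h" "\<And>x. x \<in> X \<Longrightarrow> h x = 1"
    and "linear f" and le: "\<And>x. x \<in> X \<Longrightarrow> f x \<le> b"
  shows "facet_defining (convex hull X) f b \<longleftrightarrow> dim X = dim {x \<in> X. f x = b} + 1"
proof -
  have "convex (f -` {..b})"
    using assms(4) by (intro convex_linear_vimage) auto
  then have "convex hull X \<subseteq> f -` {..b}"
    using le by (intro hull_minimal) auto
  then have "valid_ineq (convex hull X) f b"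
    unfolding valid_ineq_def by auto
  moreover have eq: "{x \<in> convex hull X. f x = b} = convex hull {x \<in> X. f x = b}"
    by (rule face_of_convex_hull) (use assms in auto)
  have "pdim {x \<in> convex hull X. f x = b} = int (dim {x \<in> X. f x = b}) - 1"
    unfolding eq by (rule pdim_convex_hull[of _ h]) (use assms(1-3) in auto)
  moreover have "pdim (convex hull X) = int (dim X) - 1"
    by (rule pdim_convex_hull[of _ h]) (use assms(1-3) in auto)
  ultimately show ?thesis
    unfolding facet_defining_def by auto
qed

text \<open>The dual test for a facet. \<open>x0\<close> is outside the span of the face because
  \<open>f - b * h\<close> vanishes on the face but not at \<open>x0\<close>. If the face and
  \<open>x0\<close> did not span \<open>X\<close>, some functional would vanish on both but not at a
  further point, which \<open>eqs\<close> forbids.\<close>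

lemma facet_definingI:
  fixes h :: "(arc \<Rightarrow> real) \<Rightarrow> real"
  assumes "finite X" "linear h" "\<And>x. x \<in> X \<Longrightarrow> h x = 1"
    and "linear f" "\<And>x. x \<in> X \<Longrightarrow> f x \<le> b"
    and x0: "x0 \<in> X" "f x0 \<noteq> b"
    and eqs: "\<And>g :: _ \<Rightarrow> real. linear g \<Longrightarrow> (\<And>x. x \<in> X \<Longrightarrow> f x = b \<Longrightarrow> g x = 0) \<Longrightarrow>
      \<exists>l. \<forall>x\<in>X. g x = l * (f x - b)"
  shows "facet_defining (convex hull X) f b"
proof -
  let ?F = "{x \<in> X. f x = b}"
  have x0F: "x0 \<notin> span ?F"
  proof
    assume "x0 \<in> span ?F"
    moreover have "linear (\<lambda>x. f x - b * h x)"
      using assms(2,4) by (intro linear_compose_sub linear_compose_scale_right) (auto simp: linear_iff algebra_simps)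
    ultimately have "f x0 - b * h x0 = 0"
      using assms(3) linear_eq_0_on_span[of "\<lambda>x. f x - b * h x" ?F x0] by auto
    then show False using x0 assms(3) by simp
  qed
  have "X \<subseteq> span (insert x0 ?F)"
  proof (rule ccontr)
    assume "\<not> ?thesis"
    then obtain y where y: "y \<in> X" "y \<notin> span (insert x0 ?F)" by blast
    obtain B where B: "B \<subseteq> insert x0 ?F" "independent B" "insert x0 ?F \<subseteq> span B"
      by (rule real_vector.basis_exists[of "insert x0 ?F"])
    have "y \<notin> span B"
      using y(2) real_vector.span_mono[OF B(1)] by blast
    then have "independent (insert y B)" "y \<notin> B"
      using B(2) real_vector.span_base by (auto simp: real_vector.independent_insert)
    then obtain g :: "_ \<Rightarrow> real" where g: "linear g" "\<forall>x\<in>insert y B. g x = (if x = y then 1 else 0)"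
      using real_vector.linear_independent_extend[of "insert y B" "\<lambda>x. if x = y then 1 else 0 :: real"] by blast
    have "g x = 0" if "x \<in> insert x0 ?F" for x
    proof (rule linear_eq_0_on_span[OF g(1)])
      show "x \<in> span B" using B(3) that by blast
      show "g v = 0" if "v \<in> B" for v using that g(2) \<open>y \<notin> B\<close> by auto
    qed
    \<comment> \<open>As \<open>f x0 - b\<close> is nonzero and \<open>g x0 = 0\<close>, the factor
      \<open>l\<close> is 0, against \<open>g y = 1\<close>.\<close>
    with eqs[OF g(1)] x0 obtain l where "\<forall>x\<in>X. g x = l * (f x - b)" "g x0 = 0" by auto
    with x0 y(1) g(2) show False by auto
  qed
  moreover have "?F \<subseteq> X" by auto
  ultimately have "span X = span (insert x0 ?F)"
    using x0(1) by (metis (no_types, lifting) insert_subset real_vector.span_mono real_vector.span_minimal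
        real_vector.subspace_span subset_antisym)
  then have "dim X = dim (insert x0 ?F)" by (rule real_vector.span_eq_dim)
  also have "\<dots> = dim ?F + 1"
    using assms(1) x0F by (intro dim_insert_notin_span) auto
  finally show ?thesis
    using facet_defining_convex_hull_iff[OF assms(1-5)] by simp
qed

text \<open>A basis of the face extends to one of \<open>X\<close> by a single point
  \<open>z\<close>, so functionals vanishing on the face are proportional on \<open>X\<close>.
  Cross-multiplication states this without an exception for vanishing functionals; two paths that
  violate it refute a facet.\<close>

lemma facet_definingD:
  fixes h g g' :: "(arc \<Rightarrow> real) \<Rightarrow> real"
  assumes "finite X" "linear h" "\<And>x. x \<in> X \<Longrightarrow> h x = 1"
    and "linear f" "\<And>x. x \<in> X \<Longrightarrow> f x \<le> b"
    and facet: "facet_defining (convex hull X) f b"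
    and g: "linear g" "\<And>x. x \<in> X \<Longrightarrow> f x = b \<Longrightarrow> g x = 0"
    and g': "linear g'" "\<And>x. x \<in> X \<Longrightarrow> f x = b \<Longrightarrow> g' x = 0"
    and "x \<in> X" "y \<in> X"
  shows "g x * g' y = g y * g' x"
proof -
  let ?F = "{x \<in> X. f x = b}"
  have dim: "dim X = dim ?F + 1"
    using facet facet_defining_convex_hull_iff[OF assms(1-5)] by simp
  obtain B where B: "B \<subseteq> ?F" "independent B" "?F \<subseteq> span B" "card B = dim ?F"
    using real_vector.basis_exists by blast
  then obtain B' where B': "B \<subseteq> B'" "B' \<subseteq> X" "independent B'" "X \<subseteq> span B'"
    using real_vector.maximal_independent_subset_extend[of B X] by (metis (no_types, lifting) mem_Collect_eq subset_iff)
  have fin: "finite B'" using B'(2) assms(1) finite_subset by blast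
  have "card B' = card B + 1"
    using real_vector.basis_card_eq_dim[OF B'(2,4,3)] dim B(4) by simp
  then have "card (B' - B) = 1"
    using B'(1) fin by (simp add: card_Diff_subset finite_subset)
  then obtain z where "B' - B = {z}" by (auto simp: card_1_singleton_iff)
  then have z: "B' = insert z B" using B'(1) by auto
  have lin: "linear (\<lambda>v. g v * g' z - g z * g' v)"
    using g(1) g'(1) by (auto simp: linear_iff algebra_simps)
  have "g v * g' z - g z * g' v = 0" if "v \<in> X" for v
  proof (rule linear_eq_0_on_span[OF lin])
    show "v \<in> span B'" using that B'(4) by blast
    show "g v * g' z - g z * g' v = 0" if "v \<in> B'" for v using that B(1) z g(2) g'(2) by auto
  qed
  then have "g x * g' z = g z * g' x" "g y * g' z = g z * g' y"
    using \<open>x \<in> X\<close> \<open>y \<in> X\<close> by auto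
  \<comment> \<open>If both functionals vanish at \<open>z\<close>, they vanish on all of
    \<open>X\<close>; otherwise one of the factors \<open>g z\<close>, \<open>g' z\<close> can be
    cancelled below.\<close>
  moreover have "g x = 0 \<and> g' x = 0" if "g z = 0" "g' z = 0"
  proof -
    have *: "g v = 0 \<and> g' v = 0" if "v \<in> B'" for v
      using that B(1) z g(2) g'(2) \<open>g z = 0\<close> \<open>g' z = 0\<close> by auto
    have "x \<in> span B'" using B'(4) \<open>x \<in> X\<close> by blast
    then show ?thesis
      using linear_eq_0_on_span[OF g(1), of B' x] linear_eq_0_on_span[OF g'(1), of B' x] * by auto
  qed
  moreover have "g z * (g x * g' y - g y * g' x) = 0" "g' z * (g x * g' y - g y * g' x) = 0"
    using calculation(1,2) by algebra+
  ultimately show ?thesis by (cases "g z = 0"; cases "g' z = 0") auto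
qed

section \<open>Paths and their costs\<close>

text \<open>Recursion over the node list, rather than a sum over arcs, lets simplification evaluate
  explicit node sequences; \<open>sum_path_arcs\<close> links the two forms.\<close>

fun pcost :: "(nat \<Rightarrow> nat \<Rightarrow> real) \<Rightarrow> nat list \<Rightarrow> real" where
  "pcost c (u # v # vs) = c u v + pcost c (v # vs)"
| "pcost c _ = 0"

lemma pcost_append: "pcost c (xs @ y # ys) = pcost c (xs @ [y]) + pcost c (y # ys)"
proof (induction xs)
  case (Cons x xs)
  then show ?case by (cases xs) auto
qed auto

lemma pcost_add: "pcost (\<lambda>u v. c u v + d u v) vs = pcost c vs + pcost d vs"
  by (induction vs rule: pcost.induct[of _ "c"]) auto

lemma pcost_scale: "pcost (\<lambda>u v. a * c u v) vs = a * pcost c vs"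
  by (induction vs rule: pcost.induct[of _ "c"]) (auto simp: distrib_left)

lemma pcost_const: "pcost (\<lambda>u v. a) (x # xs) = a * real (length xs)"
  by (induction xs arbitrary: x) (auto simp: algebra_simps)

lemma pcost_potential: "pcost (\<lambda>u v. f u - f v) (x # xs @ [y]) = f x - f y"
  by (induction xs arbitrary: x) auto

lemma pcost_tail: "pcost (\<lambda>u v. f u) (x # xs @ [y]) = f x + sum_list (map f xs)"
  by (induction xs arbitrary: x) auto

lemma pcost_head: "pcost (\<lambda>u v. f v) (x # xs @ [y]) = sum_list (map f xs) + f y"
  by (induction xs arbitrary: x) auto

lemma path_arcs_simps:
  "path_arcs [] = {}" "path_arcs [u] = {}"
  "path_arcs (u # v # vs) = insert (u, v) (path_arcs (v # vs))"
  by (auto simp: path_arcs_def)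

lemma path_arcs_subset: "path_arcs vs \<subseteq> set vs \<times> set vs"
  by (induction vs rule: induct_list012) (auto simp: path_arcs_simps)

lemma path_arcs_append: "(u, v) \<in> path_arcs (xs @ u # v # ys)"
proof (induction xs)
  case (Cons x xs)
  then show ?case by (cases xs) (auto simp: path_arcs_simps)
qed (auto simp: path_arcs_simps)

lemma finite_path_arcs [simp]: "finite (path_arcs vs)"
  by (simp add: path_arcs_def)

lemma pcost_cong: "(\<And>u v. (u, v) \<in> path_arcs vs \<Longrightarrow> c u v = d u v) \<Longrightarrow> pcost c vs = pcost d vs"
  by (induction vs rule: induct_list012) (auto simp: path_arcs_simps)

lemma pcost_nonneg: "(\<And>u v. c u v \<ge> 0) \<Longrightarrow> pcost c vs \<ge> 0"
  by (induction vs rule: induct_list012) auto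

lemma pcost_ge_arc: "(\<And>u v. c u v \<ge> 0) \<Longrightarrow> (u, v) \<in> path_arcs vs \<Longrightarrow> pcost c vs \<ge> c u v"
proof (induction vs rule: induct_list012)
  case (3 x y zs)
  then show ?case
    using pcost_nonneg[of c "y # zs"] by (auto simp: path_arcs_simps add_increasing)
qed (auto simp: path_arcs_simps)

lemma sum_path_arcs: "distinct vs \<Longrightarrow> (\<Sum>(u, v)\<in>path_arcs vs. c u v) = pcost c vs"
proof (induction vs rule: induct_list012)
  case (3 x y zs)
  moreover have "(x, y) \<notin> path_arcs (y # zs)"
    using 3(3) path_arcs_subset by fastforce
  ultimately show ?case by (simp add: path_arcs_simps)
qed (auto simp: path_arcs_simps)

lemma sum_fun_apply: "(sum f A) x = (\<Sum>a\<in>A. f a x)"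
  by (induction A rule: infinite_finite_induct) auto

text \<open>Incidence vectors are sums of unit vectors, so on paths any linear functional acts as an
  arc cost.\<close>

lemma linear_incidence:
  fixes g :: "(arc \<Rightarrow> real) \<Rightarrow> real"
  assumes "linear g" "distinct vs"
  shows "g (incidence vs) = pcost (\<lambda>u v. g (\<lambda>e. if e = (u, v) then 1 else 0)) vs"
proof -
  have "incidence vs = (\<Sum>e'\<in>path_arcs vs. (\<lambda>e. if e = e' then 1 else 0))"
    by (auto simp: fun_eq_iff sum_fun_apply incidence_def)
  then have "g (incidence vs) = (\<Sum>e'\<in>path_arcs vs. g (\<lambda>e. if e = e' then 1 else 0))"
    using assms(1) by (simp add: linear_sum)
  also have "\<dots> = (\<Sum>(u, v)\<in>path_arcs vs. g (\<lambda>e. if e = (u, v) then 1 else 0))"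
    by (intro sum.cong) auto
  also have "\<dots> = pcost (\<lambda>u v. g (\<lambda>e. if e = (u, v) then 1 else 0)) vs"
    by (rule sum_path_arcs[OF assms(2)])
  finally show ?thesis .
qed

text \<open>All arcs between inner nodes exist, so for \<open>p >= 2\<close> any
  \<open>p - 1\<close> distinct inner nodes in any order give a path between the fixed ends.\<close>

definition inner_path :: "nat \<Rightarrow> nat \<Rightarrow> nat list \<Rightarrow> bool" where
  "inner_path n p us \<longleftrightarrow> distinct us \<and> length us + 1 = p \<and> set us \<subseteq> {0<..<n}"

lemma is_p_path_iff:
  assumes "2 \<le> p"
  shows "is_p_path n p vs \<longleftrightarrow> (\<exists>us. inner_path n p us \<and> 0 < n \<and> vs = 0 # us @ [n])"
proof
  assume L: "is_p_path n p vs"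
  then have len: "length vs = p + 1" and d: "distinct vs" and "hd vs = 0" "last vs = n"
    and arc: "\<And>i. i < p \<Longrightarrow> (vs ! i, vs ! (i + 1)) \<in> arcs n"
    by (auto simp: is_p_path_def)
  then obtain ws where ws: "vs = 0 # ws" by (cases vs) auto
  with len assms have "ws \<noteq> []" by auto
  then obtain us y where "ws = us @ [y]" by (cases ws rule: rev_cases) auto
  with ws \<open>last vs = n\<close> have vs: "vs = 0 # us @ [n]" by auto
  have "u \<in> {0<..<n}" if u: "u \<in> set us" for u
  proof -
    from u vs obtain i where i: "i < length vs" "vs ! i = u"
      by (metis in_set_conv_nth list.set_intros(2) Un_iff set_append)
    have "u \<noteq> n" "u > 0" using d vs u by (auto intro!: gr0I)
    moreover from i len \<open>u \<noteq> n\<close> vs have "i < p"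
      by (metis \<open>last vs = n\<close> add_diff_cancel_right' last_conv_nth less_Suc_eq Suc_eq_plus1 list.distinct(1))
    then have "u \<le> n" using arc[of i] i by (auto simp: arcs_def)
    ultimately show ?thesis by auto
  qed
  then show "\<exists>us. inner_path n p us \<and> 0 < n \<and> vs = 0 # us @ [n]"
    using vs d len by (auto simp: inner_path_def)
next
  assume "\<exists>us. inner_path n p us \<and> 0 < n \<and> vs = 0 # us @ [n]"
  then obtain us where us: "inner_path n p us" "0 < n" and vs: "vs = 0 # us @ [n]" by blast
  then have d: "distinct vs" and len: "length vs = p + 1" and sub: "set vs \<subseteq> {0..n}"
    by (auto simp: inner_path_def less_imp_le)
  have v0: "vs ! 0 = 0" and vp: "vs ! p = n"
    using vs len by (auto simp: nth_append nth_Cons')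
  have "(vs ! i, vs ! (i + 1)) \<in> arcs n" if "i < p" for i
  proof -
    have "vs ! i \<noteq> vs ! (i + 1)" "vs ! (i + 1) \<noteq> vs ! 0" "vs ! i \<noteq> vs ! p"
      using that len d by (auto simp: nth_eq_iff_index_eq)
    moreover have "vs ! i \<noteq> vs ! 0 \<or> vs ! (i + 1) \<noteq> vs ! p"
      using that len d assms by (auto simp: nth_eq_iff_index_eq)
    moreover have "vs ! i \<in> {0..n}" "vs ! (i + 1) \<in> {0..n}"
      by (intro subsetD[OF sub] nth_mem; use that len in simp)+
    ultimately show ?thesis using v0 vp by (auto simp: arcs_def)
  qed
  then show "is_p_path n p vs"
    using vs d len by (auto simp: is_p_path_def)
qed

lemma finite_arcs [simp]: "finite (arcs n)"
  by (rule finite_subset[of _ "{0..n} \<times> {0..n}"]) (auto simp: arcs_def)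

lemma path_arcs_subset_arcs: "is_p_path n p vs \<Longrightarrow> path_arcs vs \<subseteq> arcs n"
  by (auto simp: is_p_path_def path_arcs_def set_zip nth_tl)

definition lincost :: "nat \<Rightarrow> (nat \<Rightarrow> nat \<Rightarrow> real) \<Rightarrow> (arc \<Rightarrow> real) \<Rightarrow> real" where
  "lincost n c x = (\<Sum>(u, v)\<in>arcs n. c u v * x (u, v))"

lemma linear_lincost: "linear (lincost n c)"
  by (auto simp: linear_iff lincost_def scaleR_fun_def sum.distrib sum_distrib_left algebra_simps
      split_def)

lemma lincost_incidence:
  assumes "is_p_path n p vs"
  shows "lincost n c (incidence vs) = pcost c vs"
proof -
  have "lincost n c (incidence vs) = (\<Sum>(u, v)\<in>path_arcs vs. c u v)"
    unfolding lincost_def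
    by (rule sum.mono_neutral_cong_right) (use path_arcs_subset_arcs[OF assms] in \<open>auto simp: incidence_def\<close>)
  then show ?thesis
    using assms sum_path_arcs[of vs c] by (simp add: is_p_path_def)
qed

lemma inner_path_exists:
  assumes "set xs \<subseteq> {0<..<n}" "distinct xs" "length xs < p" "p < n" "A \<subseteq> {0<..<n}" "A \<inter> set xs = {}"
    "p \<le> card A + length xs + 1"
  shows "\<exists>ys. inner_path n p (xs @ ys) \<and> set ys \<subseteq> A"
proof -
  have fin: "finite A" using assms(5) finite_subset by blast
  obtain B where B: "B \<subseteq> A" "card B = p - 1 - length xs"
    using obtain_subset_with_card_n[of "p - 1 - length xs" A] assms(7)
    by (metis diff_diff_left le_diff_conv add.commute add.left_commute)
  obtain ys where "set ys = B" "distinct ys"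
    using finite_distinct_list[of B] B fin finite_subset by blast
  then show ?thesis
    using B assms distinct_card[of ys] by (intro exI[of _ ys]) (auto simp: inner_path_def)
qed

section \<open>The generalized max-cut inequality\<close>

locale gmc =
  fixes n p :: nat and R S T :: "nat set"
  assumes p4: "4 \<le> p" and pn: "p < n"
    and part: "R \<union> S \<union> T = {0..n}" "R \<inter> S = {}" "R \<inter> T = {}" "S \<inter> T = {}"
    and ends: "0 \<in> S" "n \<in> S"
begin

definition w :: "nat \<Rightarrow> nat \<Rightarrow> real" where
  "w u v = of_bool (u \<in> S \<and> v \<in> T) + of_bool (u \<in> R)"

definition b :: nat where "b = (p + card R) div 2"

definition tight :: "nat list \<Rightarrow> bool" where
  "tight us \<longleftrightarrow> inner_path n p us \<and> pcost w (0 # us @ [n]) = real b"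

abbreviation S' :: "nat set" where "S' \<equiv> S - {0, n}"

lemma fin: "finite R" "finite S" "finite T"
  using part(1) finite_subset[of _ "{0..n}"] by blast+

lemma inner_nodes: "{0<..<n} = R \<union> S' \<union> T"
proof -
  have "{0<..<n} = {0..n} - {0, n}" by auto
  also have "\<dots> = R \<union> S' \<union> T" using part ends by auto
  finally show ?thesis .
qed

lemma card_inner_nodes: "card R + card S' + card T = n - 1"
proof -
  have "card (R \<union> S' \<union> T) = card (R \<union> S') + card T"
    using fin part by (intro card_Un_disjoint) auto
  also have "card (R \<union> S') = card R + card S'"
    using fin part by (intro card_Un_disjoint) auto
  finally show ?thesis using inner_nodes by (metis card_greaterThanLessThan diff_zero Suc_eq_plus1 diff_diff_left plus_1_eq_Suc One_nat_def)
qed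

lemma memT: "t \<in> T \<Longrightarrow> t \<notin> S \<and> t \<notin> R \<and> t \<noteq> 0 \<and> t \<noteq> n \<and> 0 < t \<and> t < n"
  using part ends inner_nodes by (metis Un_iff disjoint_iff greaterThanLessThan_iff)

lemma memR: "t \<in> R \<Longrightarrow> t \<notin> S \<and> t \<notin> T \<and> t \<noteq> 0 \<and> t \<noteq> n \<and> 0 < t \<and> t < n"
  using part ends inner_nodes by (metis Un_iff disjoint_iff greaterThanLessThan_iff)

lemma memS: "t \<in> S' \<Longrightarrow> t \<in> S \<and> t \<notin> R \<and> t \<notin> T \<and> t \<noteq> 0 \<and> t \<noteq> n \<and> 0 < t \<and> t < n"
  using part ends inner_nodes by (metis Diff_iff Un_iff disjoint_iff greaterThanLessThan_iff insert_iff)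

lemma mem0: "0 \<notin> T" "0 \<notin> R" "n \<notin> T" "n \<notin> R"
  using part ends by auto

lemma gmc_lhs_eq: "gmc_lhs n R S T x = lincost n w x"
proof -
  have 1: "xsum x (arcs_between n S T) = (\<Sum>(u, v)\<in>arcs n. of_bool (u \<in> S \<and> v \<in> T) * x (u, v))"
    unfolding xsum_def arcs_between_def
    by (rule sum.mono_neutral_cong_left) auto
  have "xsum x (delta_plus n i) = (\<Sum>(u, v)\<in>arcs n. of_bool (u = i) * x (u, v))" for i
    unfolding xsum_def delta_plus_def
    by (rule sum.mono_neutral_cong_left) auto
  then have "(\<Sum>i\<in>R. xsum x (delta_plus n i)) = (\<Sum>i\<in>R. \<Sum>e\<in>arcs n. of_bool (fst e = i) * x e)"
    by (simp add: split_def)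
  also have "\<dots> = (\<Sum>e\<in>arcs n. \<Sum>i\<in>R. of_bool (fst e = i) * x e)"
    by (rule sum.swap)
  also have "\<dots> = (\<Sum>(u, v)\<in>arcs n. of_bool (u \<in> R) * x (u, v))"
    using fin(1) by (intro sum.cong) (auto simp: of_bool_def if_distrib[of "\<lambda>z. z * _"] cong: if_cong)
  finally have 2: "(\<Sum>i\<in>R. xsum x (delta_plus n i)) = (\<Sum>(u, v)\<in>arcs n. of_bool (u \<in> R) * x (u, v))" .
  show ?thesis
    by (simp only: gmc_lhs_def lincost_def w_def 1 2 sum.distrib[symmetric] split_def distrib_right)
qed

lemma path_polytope_eq: "path_polytope n p = convex hull ((\<lambda>us. incidence (0 # us @ [n])) ` {us. inner_path n p us})"
proof -
  have "{incidence vs |vs. is_p_path n p vs} = (\<lambda>us. incidence (0 # us @ [n])) ` {us. inner_path n p us}"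
    using p4 pn by (auto simp: is_p_path_iff)
  then show ?thesis unfolding path_polytope_def by simp
qed

lemma is_p_path_inner: "inner_path n p us \<Longrightarrow> is_p_path n p (0 # us @ [n])"
  using p4 pn by (auto simp: is_p_path_iff)

lemma finite_inner_paths: "finite {us. inner_path n p us}"
proof (rule finite_subset)
  show "{us. inner_path n p us} \<subseteq> {us. set us \<subseteq> {0<..<n} \<and> length us = p - 1}"
    by (auto simp: inner_path_def)
qed (rule finite_lists_length_eq, simp)

lemma pcost_first: "inner_path n p us \<Longrightarrow> pcost (\<lambda>u v. of_bool (u = 0)) (0 # us @ [n]) = 1"
  unfolding pcost_tail by (auto simp: inner_path_def sum_list_distinct_conv_sum_set intro!: sum.neutral)

lemma count_inner:
  assumes "inner_path n p us"
  shows "sum_list (map (\<lambda>u. of_bool (u \<in> A)) us) = real (card (set us \<inter> A))"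
  using assms by (simp add: inner_path_def sum_list_distinct_conv_sum_set of_bool_def sum.If_cases Int_def)

lemma card_parts:
  assumes "inner_path n p us"
  shows "card (set us \<inter> R) + card (set us \<inter> S) + card (set us \<inter> T) + 1 = p"
proof -
  have "card (set us) = card (set us \<inter> R \<union> set us \<inter> S \<union> set us \<inter> T)"
    using assms inner_nodes by (intro arg_cong[where f = card]) (auto simp: inner_path_def)
  also have "\<dots> = card (set us \<inter> R \<union> set us \<inter> S) + card (set us \<inter> T)"
    using part by (intro card_Un_disjoint) auto
  also have "card (set us \<inter> R \<union> set us \<inter> S) = card (set us \<inter> R) + card (set us \<inter> S)"
    using part by (intro card_Un_disjoint) auto
  finally show ?thesis
    using assms distinct_card[of us] by (auto simp: inner_path_def)
qed

text \<open>Arcs from S to T are counted in two ways: by tails in S, less those missing T, and by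
  heads in T, less those coming from elsewhere. The \<open>+ 1\<close> in the first count is node 0,
  a tail in S; neither end lies in T.\<close>

lemma w_eq:
  assumes "inner_path n p us"
  shows "pcost w (0 # us @ [n]) = real (card (set us \<inter> R)) + real (card (set us \<inter> S)) + 1
      - pcost (\<lambda>u v. of_bool (u \<in> S \<and> v \<notin> T)) (0 # us @ [n])" (is ?A)
    and "pcost w (0 # us @ [n]) = real (card (set us \<inter> R)) + real (card (set us \<inter> T))
      - pcost (\<lambda>u v. of_bool (u \<notin> S \<and> v \<in> T)) (0 # us @ [n])" (is ?B)
proof -
  have "(\<lambda>u v. w u v + of_bool (u \<in> S \<and> v \<notin> T)) = (\<lambda>u v. of_bool (u \<in> R) + of_bool (u \<in> S))"
    by (auto simp: w_def fun_eq_iff)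
  then have "pcost w (0 # us @ [n]) + pcost (\<lambda>u v. of_bool (u \<in> S \<and> v \<notin> T)) (0 # us @ [n])
    = pcost (\<lambda>u v. of_bool (u \<in> R)) (0 # us @ [n]) + pcost (\<lambda>u v. of_bool (u \<in> S)) (0 # us @ [n])"
    by (simp only: pcost_add[symmetric])
  then show ?A
    unfolding pcost_tail count_inner[OF assms] using ends mem0 by simp
  have "(\<lambda>u v. w u v + of_bool (u \<notin> S \<and> v \<in> T)) = (\<lambda>u v. of_bool (u \<in> R) + of_bool (v \<in> T))"
    by (auto simp: w_def fun_eq_iff)
  then have "pcost w (0 # us @ [n]) + pcost (\<lambda>u v. of_bool (u \<notin> S \<and> v \<in> T)) (0 # us @ [n])
    = pcost (\<lambda>u v. of_bool (u \<in> R)) (0 # us @ [n]) + pcost (\<lambda>u v. of_bool (v \<in> T)) (0 # us @ [n])"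
    by (simp only: pcost_add[symmetric])
  then show ?B
    unfolding pcost_tail pcost_head count_inner[OF assms] using ends mem0 by simp
qed

lemma w_bounds:
  assumes "inner_path n p us"
  shows "pcost w (0 # us @ [n]) \<le> real (card (set us \<inter> R)) + real (card (set us \<inter> S)) + 1"
    and "pcost w (0 # us @ [n]) \<le> real (card (set us \<inter> R)) + real (card (set us \<inter> T))"
    and "(u, v) \<in> path_arcs (0 # us @ [n]) \<Longrightarrow> u \<in> S \<Longrightarrow> v \<notin> T \<Longrightarrow>
      pcost w (0 # us @ [n]) \<le> real (card (set us \<inter> R)) + real (card (set us \<inter> S))"
    and "(u, v) \<in> path_arcs (0 # us @ [n]) \<Longrightarrow> u \<notin> S \<Longrightarrow> v \<in> T \<Longrightarrow>
      pcost w (0 # us @ [n]) + 1 \<le> real (card (set us \<inter> R)) + real (card (set us \<inter> T))"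
proof -
  let ?f = "\<lambda>u v. of_bool (u \<in> S \<and> v \<notin> T) :: real" and ?g = "\<lambda>u v. of_bool (u \<notin> S \<and> v \<in> T) :: real"
  have "pcost ?f (0 # us @ [n]) \<ge> 0" "pcost ?g (0 # us @ [n]) \<ge> 0"
    by (auto intro!: pcost_nonneg)
  then show "pcost w (0 # us @ [n]) \<le> real (card (set us \<inter> R)) + real (card (set us \<inter> S)) + 1"
    and "pcost w (0 # us @ [n]) \<le> real (card (set us \<inter> R)) + real (card (set us \<inter> T))"
    using w_eq[OF assms] by linarith+
  assume a: "(u, v) \<in> path_arcs (0 # us @ [n])"
  have arc: "pcost ?f (0 # us @ [n]) \<ge> ?f u v" "pcost ?g (0 # us @ [n]) \<ge> ?g u v"
    by (rule pcost_ge_arc; use a in simp)+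
  then show "pcost w (0 # us @ [n]) \<le> real (card (set us \<inter> R)) + real (card (set us \<inter> S))"
    if "u \<in> S" "v \<notin> T"
    using w_eq[OF assms] that by simp
  show "pcost w (0 # us @ [n]) + 1 \<le> real (card (set us \<inter> R)) + real (card (set us \<inter> T))"
    if "u \<notin> S" "v \<in> T"
    using w_eq[OF assms] that arc by simp
qed

lemma w_le_b:
  assumes "inner_path n p us"
  shows "pcost w (0 # us @ [n]) \<le> real b"
proof -
  \<comment> \<open>Weights are integers, which allows the averaged bound to be rounded down to
    \<open>b\<close>.\<close>
  have int: "\<exists>m::nat. pcost w xs = real m" for xs
  proof (induction xs rule: induct_list012)
    case (3 x y zs)
    then obtain m where "pcost w (y # zs) = real m" by blast
    moreover have "w x y = real (of_bool (x \<in> S \<and> y \<in> T) + of_bool (x \<in> R))"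
      by (simp add: w_def)
    ultimately show ?case by (metis of_nat_add pcost.simps(1))
  qed (auto intro: exI[of _ 0])
  then obtain m where m: "pcost w (0 # us @ [n]) = real m" by blast
  have "card (set us \<inter> R) \<le> card R" using fin by (intro card_mono) auto
  then have "2 * m \<le> p + card R"
    using w_bounds(1,2)[OF assms] card_parts[OF assms] m by linarith
  then show ?thesis unfolding m b_def by simp
qed

lemma valid: "valid_ineq (path_polytope n p) (gmc_lhs n R S T) (real b)"
proof -
  have "convex (lincost n w -` {..real b})"
    by (intro convex_linear_vimage linear_lincost) auto
  then have "path_polytope n p \<subseteq> lincost n w -` {..real b}"
    unfolding path_polytope_eq
    by (rule hull_minimal[rotated]) (auto simp: lincost_incidence[OF is_p_path_inner] w_le_b)
  then show ?thesis by (auto simp: valid_ineq_def gmc_lhs_eq)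
qed

text \<open>The facet test in terms of costs: \<open>us0\<close> shows that the face is proper, and
  \<open>us1\<close> forces the constant \<open>m\<close> to be \<open>- l * b\<close> once the cost
  is 0 on tight paths.\<close>

lemma facetI:
  assumes "inner_path n p us0" "\<not> tight us0" "tight us1"
    and "\<And>c \<beta>. (\<And>us. tight us \<Longrightarrow> pcost c (0 # us @ [n]) = \<beta>) \<Longrightarrow>
      \<exists>l m. \<forall>us. inner_path n p us \<longrightarrow> pcost c (0 # us @ [n]) = l * pcost w (0 # us @ [n]) + m"
  shows "facet_defining (path_polytope n p) (gmc_lhs n R S T) (real b)"
proof -
  let ?X = "(\<lambda>us. incidence (0 # us @ [n])) ` {us. inner_path n p us}"
  have "gmc_lhs n R S T = lincost n w" using gmc_lhs_eq by auto
  moreover have "facet_defining (convex hull ?X) (lincost n w) (real b)"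
  \<comment> \<open>Every path has exactly one arc out of node 0; counting it gives the hyperplane
    off the origin.\<close>
  proof (rule facet_definingI[where h = "lincost n (\<lambda>u v. of_bool (u = 0))" and ?x0.0 = "incidence (0 # us0 @ [n])"])
    show "lincost n w (incidence (0 # us0 @ [n])) \<noteq> real b"
      using assms(1,2) by (simp add: tight_def lincost_incidence[OF is_p_path_inner])
  next
    fix g :: "(arc \<Rightarrow> real) \<Rightarrow> real"
    assume g: "linear g" "\<And>x. x \<in> ?X \<Longrightarrow> lincost n w x = real b \<Longrightarrow> g x = 0"
    define c where "c u v = g (\<lambda>e. if e = (u, v) then 1 else 0)" for u v
    have gc: "g (incidence (0 # us @ [n])) = pcost c (0 # us @ [n])" if "inner_path n p us" for us
      using linear_incidence[OF g(1), of "0 # us @ [n]"] is_p_path_inner[OF that]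
      unfolding c_def is_p_path_def by blast
    have "pcost c (0 # us @ [n]) = 0" if "tight us" for us
      using g(2)[of "incidence (0 # us @ [n])"] that gc[of us]
      by (simp add: tight_def lincost_incidence[OF is_p_path_inner])
    then obtain l m where lm: "\<And>us. inner_path n p us \<Longrightarrow> pcost c (0 # us @ [n]) = l * pcost w (0 # us @ [n]) + m"
        and "pcost c (0 # us1 @ [n]) = 0"
      using assms(4)[of c 0] assms(3) by blast
    then have "m = - l * real b" using assms(3) by (simp add: tight_def)
    then show "\<exists>l. \<forall>x\<in>?X. g x = l * (lincost n w x - real b)"
      using lm by (intro exI[of _ l]) (auto simp: gc lincost_incidence[OF is_p_path_inner] algebra_simps)
  qed (use finite_inner_paths assms(1) w_le_b in
      \<open>auto simp: linear_lincost lincost_incidence[OF is_p_path_inner] pcost_first\<close>)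
  ultimately show ?thesis by (simp add: path_polytope_eq)
qed

lemma facetD:
  assumes "facet_defining (path_polytope n p) (gmc_lhs n R S T) (real b)"
    and "\<And>us. tight us \<Longrightarrow> pcost c (0 # us @ [n]) = \<gamma>"
    and "\<And>us. tight us \<Longrightarrow> pcost d (0 # us @ [n]) = \<delta>"
    and "inner_path n p us" "inner_path n p vs"
  shows "(pcost c (0 # us @ [n]) - \<gamma>) * (pcost d (0 # vs @ [n]) - \<delta>)
    = (pcost c (0 # vs @ [n]) - \<gamma>) * (pcost d (0 # us @ [n]) - \<delta>)"
proof -
  let ?X = "(\<lambda>us. incidence (0 # us @ [n])) ` {us. inner_path n p us}"
  have eq: "gmc_lhs n R S T = lincost n w" using gmc_lhs_eq by auto
  let ?e = "lincost n (\<lambda>u v. of_bool (u = 0))"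
  \<comment> \<open>Since \<open>?e\<close> is 1 on every path, multiplying the constant by it turns
    an affine equation into a linear one.\<close>
  let ?g = "\<lambda>c \<gamma> x. lincost n c x - \<gamma> * ?e x"
  have lin: "linear (?g c \<gamma>)" for c \<gamma>
    using linear_lincost[of n c] linear_lincost[of n "\<lambda>u v. of_bool (u = 0)"]
    by (auto simp: linear_iff algebra_simps)
  have val: "?g c \<gamma> (incidence (0 # us @ [n])) = pcost c (0 # us @ [n]) - \<gamma>" if "inner_path n p us" for us c \<gamma>
    using that by (simp add: lincost_incidence[OF is_p_path_inner] pcost_first)
  have "?g c \<gamma> (incidence (0 # us @ [n])) * ?g d \<delta> (incidence (0 # vs @ [n]))
     = ?g c \<gamma> (incidence (0 # vs @ [n])) * ?g d \<delta> (incidence (0 # us @ [n]))"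
  proof (rule facet_definingD[of ?X ?e "lincost n w" "real b"])
    show "facet_defining (convex hull ?X) (lincost n w) (real b)"
      using assms(1) unfolding path_polytope_eq eq .
    show "?g c \<gamma> x = 0" if "x \<in> ?X" "lincost n w x = real b" for x
      using that assms(2) val by (auto simp: tight_def lincost_incidence[OF is_p_path_inner])
    show "?g d \<delta> x = 0" if "x \<in> ?X" "lincost n w x = real b" for x
      using that assms(3) val by (auto simp: tight_def lincost_incidence[OF is_p_path_inner])
  qed (use finite_inner_paths assms(4,5) w_le_b lin in
      \<open>auto simp: linear_lincost lincost_incidence[OF is_p_path_inner] pcost_first\<close>)
  then show ?thesis using val assms(4,5) by simp
qed

end

section \<open>Necessity of the conditions\<close>

lemma path_arcs_mem: "(u, v) \<in> path_arcs vs \<Longrightarrow> u \<in> set vs \<and> v \<in> set (tl vs)"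
  by (auto simp: path_arcs_def dest: set_zip_leftD set_zip_rightD)

lemma path_arcs_tail_unique:
  "distinct vs \<Longrightarrow> (u, v) \<in> path_arcs vs \<Longrightarrow> (u, v') \<in> path_arcs vs \<Longrightarrow> v = v'"
proof (induction vs rule: induct_list012)
  case (3 x y zs)
  then show ?case
    using path_arcs_mem[of x v "y # zs"] path_arcs_mem[of x v' "y # zs"] by (auto simp: path_arcs_simps)
qed (auto simp: path_arcs_simps)

lemma path_arcs_head_unique:
  "distinct vs \<Longrightarrow> (u, v) \<in> path_arcs vs \<Longrightarrow> (u', v) \<in> path_arcs vs \<Longrightarrow> u = u'"
proof (induction vs rule: induct_list012)
  case (3 x y zs)
  then show ?case
    using path_arcs_mem[of u y "y # zs"] path_arcs_mem[of u' y "y # zs"] by (auto simp: path_arcs_simps)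
qed (auto simp: path_arcs_simps)

lemma two_elements:
  assumes "card A \<ge> 2"
  obtains x y where "x \<in> A" "y \<in> A" "x \<noteq> y"
proof -
  obtain B where "B \<subseteq> A" "card B = 2"
    using obtain_subset_with_card_n[OF assms] by blast
  then show ?thesis using that by (auto simp: card_2_iff)
qed

lemma path_arcs_no_reverse:
  "distinct vs \<Longrightarrow> (u, v) \<in> path_arcs vs \<Longrightarrow> (v, u) \<notin> path_arcs vs"
proof (induction vs rule: induct_list012)
  case (3 x y zs)
  then show ?case using path_arcs_subset[of "y # zs"] by (auto simp: path_arcs_simps)
qed (auto simp: path_arcs_simps)

lemma pcost_arc_indicator:
  assumes "distinct vs"
  shows "pcost (\<lambda>x y. of_bool ((x, y) = e)) vs = of_bool (e \<in> path_arcs vs)"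
proof -
  have "pcost (\<lambda>x y. of_bool ((x, y) = e)) vs = (\<Sum>x\<in>path_arcs vs. of_bool (x = e))"
    unfolding sum_path_arcs[OF assms, symmetric] by (simp add: split_def)
  then show ?thesis by (simp add: of_bool_def)
qed

context gmc
begin

lemma distinct_full: "inner_path n p us \<Longrightarrow> distinct (0 # us @ [n])"
  using is_p_path_inner[of us] by (simp add: is_p_path_def)

lemma tightD: "tight us \<Longrightarrow> inner_path n p us" "tight us \<Longrightarrow> pcost w (0 # us @ [n]) = real b"
  by (simp_all add: tight_def)

text \<open>There are \<open>n - 1 >= p\<close> inner nodes and a path uses \<open>p - 1\<close>, so
  a prescribed node \<open>i\<close> can be kept out of the extension.\<close>

lemma inner_path_extend:
  assumes "set xs \<subseteq> {0<..<n}" "distinct xs" "length xs < p"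
  shows "\<exists>ys. inner_path n p (xs @ ys) \<and> i \<notin> set ys"
proof -
  let ?A = "{0<..<n} - insert i (set xs)"
  have "card (insert i (set xs)) \<le> length xs + 1"
    using card_insert_le_m1[of "length xs + 1" "set xs" i] card_length[of xs] by simp
  moreover have "card {0<..<n} - card (insert i (set xs)) \<le> card ?A"
    by (rule diff_card_le_card_Diff) simp
  ultimately have "p \<le> card ?A + length xs + 1" using pn p4 by simp
  then show ?thesis
    using inner_path_exists[OF assms pn, of ?A] by blast
qed

lemma inner_path_through_arc:
  assumes "e \<in> arcs n"
  shows "\<exists>us. inner_path n p us \<and> e \<in> path_arcs (0 # us @ [n])"
proof -
  obtain u v where e: "e = (u, v)" by force
  consider "u = 0" | "v = n" "u \<noteq> 0" | "u \<noteq> 0" "v \<noteq> n" by blast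
  then show ?thesis
  proof cases
    case 1
    then obtain ys where "inner_path n p ([v] @ ys)"
      using inner_path_extend[of "[v]"] assms e p4 by (auto simp: arcs_def)
    with 1 show ?thesis unfolding e by (intro exI[of _ "v # ys"]) (auto simp: path_arcs_simps)
  next
    case 2
    then obtain ys where "inner_path n p ([u] @ ys)"
      using inner_path_extend[of "[u]"] assms e p4 by (auto simp: arcs_def)
    then have "inner_path n p (ys @ [u])" by (auto simp: inner_path_def)
    with 2 show ?thesis
      using path_arcs_append[of u n "0 # ys" "[]"] unfolding e by (intro exI[of _ "ys @ [u]"]) auto
  next
    case 3
    then obtain ys where "inner_path n p ([u, v] @ ys)"
      using inner_path_extend[of "[u, v]"] assms e p4 by (auto simp: arcs_def)
    then show ?thesis unfolding e by (intro exI[of _ "u # v # ys"]) (auto simp: path_arcs_simps)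
  qed
qed

text \<open>Both arc variables vanish on the face. Some path uses \<open>e\<close> and, by
  \<open>excl\<close>, not \<open>e'\<close>, while another uses \<open>e'\<close>, so the two
  equations are not proportional.\<close>

lemma not_facet_two_arcs:
  assumes facet: "facet_defining (path_polytope n p) (gmc_lhs n R S T) (real b)"
    and unused: "\<And>us. tight us \<Longrightarrow> e \<notin> path_arcs (0 # us @ [n]) \<and> e' \<notin> path_arcs (0 # us @ [n])"
    and arcs: "e \<in> arcs n" "e' \<in> arcs n"
    and excl: "\<And>us. inner_path n p us \<Longrightarrow> e \<in> path_arcs (0 # us @ [n]) \<Longrightarrow> e' \<notin> path_arcs (0 # us @ [n])"
  shows False
proof -
  obtain us vs where us: "inner_path n p us" "e \<in> path_arcs (0 # us @ [n])"
    and vs: "inner_path n p vs" "e' \<in> path_arcs (0 # vs @ [n])"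
    using inner_path_through_arc arcs by blast
  let ?c = "\<lambda>e x y. of_bool ((x, y) = e)"
  have "(pcost (?c e) (0 # us @ [n]) - 0) * (pcost (?c e') (0 # vs @ [n]) - 0)
    = (pcost (?c e) (0 # vs @ [n]) - 0) * (pcost (?c e') (0 # us @ [n]) - 0)"
    by (rule facetD[OF facet _ _ us(1) vs(1)])
      (use unused in \<open>auto simp: pcost_arc_indicator[OF distinct_full[OF tightD(1)]]\<close>)
  then show False
    using excl[OF us] us vs by (simp add: pcost_arc_indicator[OF distinct_full])
qed

lemma not_facet_common_tail:
  assumes "facet_defining (path_polytope n p) (gmc_lhs n R S T) (real b)"
    and "\<And>us. tight us \<Longrightarrow> (u, v) \<notin> path_arcs (0 # us @ [n])"
    and "\<And>us. tight us \<Longrightarrow> (u, v') \<notin> path_arcs (0 # us @ [n])"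
    and "(u, v) \<in> arcs n" "(u, v') \<in> arcs n" "v \<noteq> v'"
  shows False
  using not_facet_two_arcs[OF assms(1) _ assms(4,5)] assms(2,3,6) path_arcs_tail_unique[OF distinct_full]
  by blast

lemma not_facet_common_head:
  assumes "facet_defining (path_polytope n p) (gmc_lhs n R S T) (real b)"
    and "\<And>us. tight us \<Longrightarrow> (u, v) \<notin> path_arcs (0 # us @ [n])"
    and "\<And>us. tight us \<Longrightarrow> (u', v) \<notin> path_arcs (0 # us @ [n])"
    and "(u, v) \<in> arcs n" "(u', v) \<in> arcs n" "u \<noteq> u'"
  shows False
  using not_facet_two_arcs[OF assms(1) _ assms(4,5)] assms(2,3,6) path_arcs_head_unique[OF distinct_full]
  by blast

lemma not_facet_reverse:
  assumes "facet_defining (path_polytope n p) (gmc_lhs n R S T) (real b)"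
    and "\<And>us. tight us \<Longrightarrow> (u, v) \<notin> path_arcs (0 # us @ [n])"
    and "\<And>us. tight us \<Longrightarrow> (v, u) \<notin> path_arcs (0 # us @ [n])"
    and "(u, v) \<in> arcs n" "(v, u) \<in> arcs n"
  shows False
  using not_facet_two_arcs[OF assms(1) _ assms(4,5)] assms(2,3) path_arcs_no_reverse[OF distinct_full]
  by blast

lemma arcs_mem:
  "u \<in> {0<..<n} \<Longrightarrow> (0, u) \<in> arcs n" "u \<in> {0<..<n} \<Longrightarrow> (u, n) \<in> arcs n"
  "u \<in> {0<..<n} \<Longrightarrow> v \<in> {0<..<n} \<Longrightarrow> u \<noteq> v \<Longrightarrow> (u, v) \<in> arcs n"
  by (auto simp: arcs_def)

text \<open>The second equation is now that \<open>i\<close> is visited. A path through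
  \<open>e\<close> satisfies it, and a path avoiding \<open>i\<close> violates it while omitting
  \<open>e\<close>, so it is not proportional to the vanishing of \<open>e\<close>.\<close>

lemma not_facet_node_arc:
  assumes facet: "facet_defining (path_polytope n p) (gmc_lhs n R S T) (real b)"
    and face: "\<And>us. tight us \<Longrightarrow> i \<in> set us \<and> e \<notin> path_arcs (0 # us @ [n])"
    and arcs: "e \<in> arcs n" and i: "0 < i" "i < n" and "i = fst e \<or> i = snd e"
  shows False
proof -
  have visit: "pcost (\<lambda>u v. of_bool (v = i)) (0 # us @ [n]) = of_bool (i \<in> set us)" if "inner_path n p us" for us
    unfolding pcost_head using that i count_inner[OF that, of "{i}"] by (auto simp: Int_insert_right)
  obtain us where us: "inner_path n p us" "e \<in> path_arcs (0 # us @ [n])"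
    using inner_path_through_arc[OF arcs] by blast
  obtain vs where vs: "inner_path n p vs" "i \<notin> set vs"
    using inner_path_extend[of "[]" i] p4 by auto
  have "i \<in> set (0 # us @ [n])" "e \<notin> path_arcs (0 # vs @ [n])"
    using us(2) vs(2) assms(6) i path_arcs_mem[of "fst e" "snd e" "0 # us @ [n]"]
      path_arcs_mem[of "fst e" "snd e" "0 # vs @ [n]"] by auto
  moreover have "(pcost (\<lambda>u v. of_bool (v = i)) (0 # us @ [n]) - 1) * (pcost (\<lambda>x y. of_bool ((x, y) = e)) (0 # vs @ [n]) - 0)
    = (pcost (\<lambda>u v. of_bool (v = i)) (0 # vs @ [n]) - 1) * (pcost (\<lambda>x y. of_bool ((x, y) = e)) (0 # us @ [n]) - 0)"
    by (rule facetD[OF facet _ _ us(1) vs(1)])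
      (use face in \<open>auto simp: visit[OF tightD(1)] pcost_arc_indicator[OF distinct_full[OF tightD(1)]]\<close>)
  ultimately show False
    using us vs i by (simp add: pcost_arc_indicator[OF distinct_full] visit)
qed

text \<open>These inequalities between naturals reduce the necessity arguments to linear arithmetic;
  the last two charge the slack to a single wasteful arc.\<close>

lemma tight_counts:
  assumes "tight us"
  shows "card (set us \<inter> R) + card (set us \<inter> S') + card (set us \<inter> T) + 1 = p"
    and "card (set us \<inter> R) \<le> card R" "card (set us \<inter> S') \<le> card S'" "card (set us \<inter> T) \<le> card T"
    and "b \<le> card (set us \<inter> R) + card (set us \<inter> S') + 1" "b \<le> card (set us \<inter> R) + card (set us \<inter> T)"
    and "(u, v) \<in> path_arcs (0 # us @ [n]) \<Longrightarrow> u \<in> S \<Longrightarrow> v \<notin> T \<Longrightarrow>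
      b \<le> card (set us \<inter> R) + card (set us \<inter> S')"
    and "(u, v) \<in> path_arcs (0 # us @ [n]) \<Longrightarrow> u \<notin> S \<Longrightarrow> v \<in> T \<Longrightarrow>
      b + 1 \<le> card (set us \<inter> R) + card (set us \<inter> T)"
proof -
  have in': "inner_path n p us" and wb: "pcost w (0 # us @ [n]) = real b" using assms tightD by auto
  then have eq: "set us \<inter> S' = set us \<inter> S" by (auto simp: inner_path_def)
  show "card (set us \<inter> R) + card (set us \<inter> S') + card (set us \<inter> T) + 1 = p"
    unfolding eq using card_parts[OF in'] .
  show "card (set us \<inter> R) \<le> card R" "card (set us \<inter> S') \<le> card S'" "card (set us \<inter> T) \<le> card T"
    using fin by (auto intro!: card_mono)
  show "b \<le> card (set us \<inter> R) + card (set us \<inter> S') + 1" "b \<le> card (set us \<inter> R) + card (set us \<inter> T)"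
    unfolding eq using w_bounds(1,2)[OF in'] wb by linarith+
  show "b \<le> card (set us \<inter> R) + card (set us \<inter> S')"
    if "(u, v) \<in> path_arcs (0 # us @ [n])" "u \<in> S" "v \<notin> T"
    unfolding eq using w_bounds(3)[OF in' that] wb by linarith
  show "b + 1 \<le> card (set us \<inter> R) + card (set us \<inter> T)"
    if "(u, v) \<in> path_arcs (0 # us @ [n])" "u \<notin> S" "v \<in> T"
    using w_bounds(4)[OF in' that] wb by linarith
qed

lemma tight_visits_all_R:
  assumes "card (set us \<inter> R) \<ge> card R" "i \<in> R"
  shows "i \<in> set us"
proof -
  have "set us \<inter> R = R" using assms(1) fin(1) by (intro card_seteq) auto
  then show ?thesis using assms(2) by blast
qed

text \<open>For even \<open>p + card R\<close> there is no slack: tight paths leave S only into T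
  and enter T only from S. So either two arcs from 0 to nodes outside T or two opposite arcs inside
  T lie on no tight path.\<close>

lemma facet_imp_odd:
  assumes facet: "facet_defining (path_polytope n p) (gmc_lhs n R S T) (real b)"
  shows "odd (p + card R)"
proof
  assume "even (p + card R)"
  then have b2: "2 * b = p + card R" by (auto simp: b_def)
  have slackS: "(u, v) \<notin> path_arcs (0 # us @ [n])" if "tight us" "u \<in> S" "v \<notin> T" for us u v
    using tight_counts(1-6)[OF that(1)] tight_counts(7)[OF that(1) _ that(2,3)] b2 by linarith
  have slackT: "(u, v) \<notin> path_arcs (0 # us @ [n])" if "tight us" "u \<notin> S" "v \<in> T" for us u v
    using tight_counts(1-6)[OF that(1)] tight_counts(8)[OF that(1) _ that(2,3)] b2 by linarith
  show False
  proof (cases "card (R \<union> S') \<ge> 2")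
    case True
    then obtain v v' where v: "v \<in> R \<union> S'" "v' \<in> R \<union> S'" "v \<noteq> v'"
      by (rule two_elements)
    then have "v \<in> {0<..<n}" "v' \<in> {0<..<n}" "v \<notin> T" "v' \<notin> T"
      using inner_nodes part(3,4) by auto
    then show False
      by (intro not_facet_common_tail[OF facet, of 0 v v']) (simp_all add: slackS ends arcs_mem v)
  next
    case False
    have "card (R \<union> S') = card R + card S'"
      using fin part by (intro card_Un_disjoint) auto
    with False have "card T \<ge> 2" using card_inner_nodes p4 pn by linarith
    then obtain v v' where v: "v \<in> T" "v' \<in> T" "v \<noteq> v'"
      by (rule two_elements)
    then have "v \<in> {0<..<n}" "v' \<in> {0<..<n}" "v \<notin> S" "v' \<notin> S"
      using inner_nodes part(4) by auto
    then show False
      by (intro not_facet_reverse[OF facet, of v v']) (simp_all add: slackT arcs_mem v v(3)[symmetric])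
  qed
qed

text \<open>Parity rules out \<open>p = card R + 2\<close>. For \<open>p < card R\<close> every path
  misses at least two nodes of R, too much slack. For \<open>p = card R + 1\<close> a tight path has
  no inner node in S, and one entering T from R must visit all of R, which leaves no room for T; so
  no tight path goes from R to \<open>v\<close>.\<close>

lemma facet_imp_p_ge:
  assumes facet: "facet_defining (path_polytope n p) (gmc_lhs n R S T) (real b)"
  shows "p \<ge> card R + 3"
proof (rule ccontr)
  assume "\<not> ?thesis"
  with facet_imp_odd[OF facet] have le: "p \<le> card R + 1"
    by (cases "p = card R + 2") auto
  have b2: "2 * b + 1 = p + card R" using facet_imp_odd[OF facet] by (auto simp: b_def)
  have "card R \<ge> 2" using le p4 by simp
  then obtain i i' where i: "i \<in> R" "i' \<in> R" "i \<noteq> i'"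
    by (rule two_elements)
  show False
  proof (cases "p = card R + 1")
    case False
    then have "p + 1 \<le> card R" using le facet_imp_odd[OF facet] by presburger
    then have "\<not> tight us" for us
      using tight_counts(1,5,6)[of us] b2 by linarith
    moreover have "i \<in> {0<..<n}" "i' \<in> {0<..<n}" using i inner_nodes by auto
    ultimately show False
      by (intro not_facet_reverse[OF facet, of i i']) (simp_all add: arcs_mem i i(3)[symmetric])
  next
    case True
    have "card S' + card T \<noteq> 0" using True card_inner_nodes pn by linarith
    then obtain v where v: "v \<in> S' \<union> T" by (metis UnI1 UnI2 add_is_0 all_not_in_conv card.empty)
    have "(j, v) \<notin> path_arcs (0 # us @ [n])" if "tight us" "j \<in> R" for us j
    proof
      assume a: "(j, v) \<in> path_arcs (0 # us @ [n])"
      have "v \<noteq> n" using v memT by blast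
      then have "v \<in> set us" using path_arcs_mem[OF a] by simp
      show False
      proof (cases "v \<in> T")
        case True
        then have "card (set us \<inter> T) \<noteq> 0" using \<open>v \<in> set us\<close> by auto
        then show False
          using tight_counts(1,2,5)[OF that(1)] tight_counts(8)[OF that(1) a _ True] memR[OF that(2)] b2 le by linarith
      next
        case False
        then have "card (set us \<inter> S') \<noteq> 0" using \<open>v \<in> set us\<close> v by auto
        then show False
          using tight_counts(1,2,5,6)[OF that(1)] b2 \<open>p = card R + 1\<close> by linarith
      qed
    qed
    moreover have "i \<in> {0<..<n}" "i' \<in> {0<..<n}" "v \<in> {0<..<n}" "v \<noteq> i" "v \<noteq> i'"
      using i v part(2,3) inner_nodes by auto
    ultimately show False
      by (intro not_facet_common_head[OF facet, of i v i']) (simp_all add: arcs_mem i)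
  qed
qed

lemma facet_imp_tight_exists:
  assumes facet: "facet_defining (path_polytope n p) (gmc_lhs n R S T) (real b)"
  shows "\<exists>us. tight us"
proof (rule ccontr)
  assume "\<not> ?thesis"
  then show False
    using p4 pn arcs_mem(1)[of 1] arcs_mem(1)[of 2] not_facet_common_tail[OF facet, of 0 1 2] by simp
qed

text \<open>Write \<open>p = card R + 2 * k + 1\<close>. With fewer than \<open>k\<close> inner
  nodes in S the slack must be spent on entering T from outside S. So tight paths visit all of R and
  leave S only into T, which excludes an arc from 0 into R or, for empty R, the arcs from 0 to
  \<open>s\<close> and from \<open>s\<close> to \<open>n\<close>.\<close>

lemma facet_imp_card_S:
  assumes facet: "facet_defining (path_polytope n p) (gmc_lhs n R S T) (real b)"
  shows "p \<le> card R + 2 * card S' + 1"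
proof (rule ccontr)
  assume small: "\<not> ?thesis"
  have b2: "2 * b + 1 = p + card R" using facet_imp_odd[OF facet] by (auto simp: b_def)
  have slackS: "(u, v) \<notin> path_arcs (0 # us @ [n])" if "tight us" "u \<in> S" "v \<notin> T" for us u v
    using tight_counts(1-6)[OF that(1)] tight_counts(7)[OF that(1) _ that(2,3)] b2 small by linarith
  have full: "card (set us \<inter> R) \<ge> card R" if "tight us" for us
    using tight_counts(1-6)[OF that] b2 small by linarith
  show False
  proof (cases "R = {}")
    case False
    then obtain i where i: "i \<in> R" by blast
    show False
      using memR[OF i] i ends tight_visits_all_R[OF full]
      by (intro not_facet_node_arc[OF facet, of i "(0, i)"]) (auto simp: arcs_def slackS)
  next
    case True
    obtain us where us: "tight us" using facet_imp_tight_exists[OF facet] by blast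
    have "card S' \<noteq> 0" using tight_counts(1-6)[OF us] b2 True p4 by simp
    then obtain s where s: "s \<in> S'" by (metis all_not_in_conv card.empty)
    \<comment> \<open>A path with both arcs would be 0, \<open>s\<close>, \<open>n\<close>, too
      short for \<open>p >= 4\<close>.\<close>
    have "(s, n) \<notin> path_arcs (0 # us @ [n])" if "inner_path n p us" "(0, s) \<in> path_arcs (0 # us @ [n])" for us
    proof
      assume a: "(s, n) \<in> path_arcs (0 # us @ [n])"
      have "length us + 1 = p" using that(1) by (simp add: inner_path_def)
      then obtain x y zs where us: "us = x # y # zs"
        using p4 by (cases us; cases "tl us") auto
      have d: "distinct (0 # us @ [n])" using distinct_full[OF that(1)] .
      have "x = s" using path_arcs_tail_unique[OF d that(2), of x] us by (auto simp: path_arcs_simps)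
      then have "y = n" using path_arcs_tail_unique[OF d a, of y] us by (auto simp: path_arcs_simps)
      then show False using d us by auto
    qed
    then show False
      using memS[OF s] ends mem0
      by (intro not_facet_two_arcs[OF facet, of "(0, s)" "(s, n)"]) (auto simp: arcs_def slackS)
  qed
qed

text \<open>With \<open>k\<close> as before and at most \<open>k\<close> nodes in T, the slack must
  go to an arc leaving S for a node outside T. So tight paths visit all of R and enter T only from
  S, which excludes arcs from R to T or, for empty R, the arcs inside T.\<close>

lemma facet_imp_card_T:
  assumes facet: "facet_defining (path_polytope n p) (gmc_lhs n R S T) (real b)"
  shows "p + 1 \<le> card R + 2 * card T"
proof (rule ccontr)
  assume small: "\<not> ?thesis"
  have b2: "2 * b + 1 = p + card R" using facet_imp_odd[OF facet] by (auto simp: b_def)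
  have slackT: "(u, v) \<notin> path_arcs (0 # us @ [n])" if "tight us" "u \<notin> S" "v \<in> T" for us u v
    using tight_counts(1-6)[OF that(1)] tight_counts(8)[OF that(1) _ that(2,3)] b2 small by linarith
  have full: "card (set us \<inter> R) \<ge> card R" if "tight us" for us
    using tight_counts(1-6)[OF that] b2 small by linarith
  obtain us where us: "tight us" using facet_imp_tight_exists[OF facet] by blast
  have T1: "2 * card T + card R + 1 \<ge> p"
    using tight_counts(1-6)[OF us] b2 by linarith
  show False
  proof (cases "R = {}")
    case False
    then obtain i where i: "i \<in> R" by blast
    have "card T \<noteq> 0" using T1 facet_imp_p_ge[OF facet] by linarith
    then obtain t where t: "t \<in> T" by (metis all_not_in_conv card.empty)
    show False
      using memR[OF i] i t memT[OF t] tight_visits_all_R[OF full]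
      by (intro not_facet_node_arc[OF facet, of i "(i, t)"]) (auto simp: arcs_def slackT)
  next
    case True
    then have "card T \<ge> 2" using T1 p4 by simp
    then obtain v v' where v: "v \<in> T" "v' \<in> T" "v \<noteq> v'"
      by (rule two_elements)
    then have "v \<in> {0<..<n}" "v' \<in> {0<..<n}" "v \<notin> S" "v' \<notin> S"
      using inner_nodes part(4) by auto
    then show False
      by (intro not_facet_reverse[OF facet, of v v']) (simp_all add: slackT arcs_mem v v(3)[symmetric])
  qed
qed

text \<open>Weight \<open>card R + 1\<close> takes at least that many of the
  \<open>card R + 2\<close> inner nodes from R and T. So a tight path has at most one inner node of
  S, and arcs joining two of them are excluded in both directions.\<close>

lemma facet_imp_card_S_le:
  assumes facet: "facet_defining (path_polytope n p) (gmc_lhs n R S T) (real b)"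
    and p: "p = card R + 3"
  shows "card S' \<le> 1"
proof (rule ccontr)
  assume "\<not> ?thesis"
  then have "card S' \<ge> 2" by simp
  then obtain s s' where s: "s \<in> S'" "s' \<in> S'" "s \<noteq> s'"
    by (rule two_elements)
  have b2: "b = card R + 1" unfolding b_def using p by simp
  have "(u, v) \<notin> path_arcs (0 # us @ [n])" if "tight us" "u \<in> S'" "v \<in> S'" "u \<noteq> v" for us u v
  proof
    assume a: "(u, v) \<in> path_arcs (0 # us @ [n])"
    then have "{u, v} \<subseteq> set us \<inter> S'"
      using that path_arcs_mem[OF a] by auto
    then have "card (set us \<inter> S') \<ge> 2"
      using card_mono[of "set us \<inter> S'" "{u, v}"] that(4) by auto
    then show False
      using tight_counts(1-6)[OF that(1)] b2 p by linarith
  qed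
  note unused = this
  have "s \<in> {0<..<n}" "s' \<in> {0<..<n}" using s inner_nodes by auto
  then show False
    by (intro not_facet_reverse[OF facet unused[OF _ s] unused[OF _ s(2,1)]])
      (simp_all add: arcs_mem s(3) s(3)[symmetric])
qed

end

section \<open>The exceptional equation for p = 4 and one node in R\<close>

context gmc
begin

text \<open>Here \<open>card R = 1\<close> and \<open>p = 4\<close>, and every arc lies on some
  tight path, so another kind of equation is needed. A path from \<open>i\<close> directly to
  \<open>s\<close> has one more inner node, before or after the two; on tight paths that arc is used
  exactly when one of the arcs from 0 to \<open>i\<close> and from \<open>s\<close> to
  \<open>n\<close> is.\<close>

lemma facet_imp_card_R:
  assumes facet: "facet_defining (path_polytope n p) (gmc_lhs n R S T) (real b)"
    and p: "p = card R + 3"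
  shows "card R \<ge> 2"
proof (rule ccontr)
  assume "\<not> ?thesis"
  with p p4 have "card R = 1" and p: "p = 4" by auto
  then obtain i where R: "R = {i}" by (auto simp: card_1_singleton_iff)
  have "card S' = 1"
    using facet_imp_card_S_le[OF facet] facet_imp_card_S[OF facet] p \<open>card R = 1\<close> by simp
  then obtain s where S: "S' = {s}" by (auto simp: card_1_singleton_iff)
  have b2: "b = 2" unfolding b_def using p \<open>card R = 1\<close> by simp
  have "card T \<ge> 2" using card_inner_nodes p pn \<open>card R = 1\<close> \<open>card S' = 1\<close> by simp
  then obtain t t' where t: "t \<in> T" "t' \<in> T" "t \<noteq> t'"
    by (rule two_elements)
  have m: "i \<in> R" "s \<in> S'" using R S by auto
  note mem = memR[OF m(1)] memS[OF m(2)] memT[OF t(1)] memT[OF t(2)] mem0 ends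
  define g where "g u v = of_bool (u = i \<and> v = s) - of_bool (u = s \<and> v = n) - (of_bool (u = 0 \<and> v = i) :: real)" for u v
  have T': "v \<noteq> i" "v \<noteq> s" "v \<noteq> n" "v \<noteq> 0" if "v \<in> T" for v
    using memT[OF that] mem R by auto
  have wT: "w u v = 0" if "u \<in> T" for u v using memT[OF that] by (auto simp: w_def)
  have ws: "w s v = of_bool (v \<in> T)" "w 0 v = of_bool (v \<in> T)" "w i v = 1" for v
    using mem m by (auto simp: w_def)
  have gT: "g u v = 0" if "u \<in> T" for u v using T'[OF that] by (auto simp: g_def)
  have gs: "g s v = - of_bool (v = n)" "g 0 v = - of_bool (v = i)" "g i v = of_bool (v = s)" for v
    using mem m by (auto simp: g_def)
  have ne: "i \<noteq> s" "s \<noteq> i" "i \<notin> T" "s \<notin> T" "n \<notin> T" "n \<noteq> s" "s \<noteq> n" "i \<noteq> n"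
    using mem by auto
  have g0: "pcost g (0 # us @ [n]) = 0" if "tight us" for us
  proof -
    have "distinct us" "length us = 3" "set us \<subseteq> {0<..<n}"
      using tightD(1)[OF that] p by (auto simp: inner_path_def)
    then obtain x y z where us: "us = [x, y, z]" and d: "x \<noteq> y" "y \<noteq> z" "x \<noteq> z"
      and sub: "x \<in> {0<..<n}" "y \<in> {0<..<n}" "z \<in> {0<..<n}"
      by (auto simp: numeral_eq_Suc length_Suc_conv)
    have w2: "w 0 x + w x y + w y z + w z n = 2"
      using tightD(2)[OF that] us b2 by simp
    have *: "v = i \<or> v = s \<or> v \<in> T" if "v \<in> {0<..<n}" for v
      using that inner_nodes R S by blast
    consider (i) "x = i" | (s) "x = s" | (t) "x \<in> T" using *[OF sub(1)] by blast
    then have "g 0 x + g x y + g y z + g z n = 0"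
    proof cases
      case i
      then show ?thesis
        using w2 d *[OF sub(2)] *[OF sub(3)] by (auto simp: wT ws gT gs ne T')
    next
      case s
      then show ?thesis
        using w2 d *[OF sub(2)] *[OF sub(3)] by (auto simp: wT ws gT gs ne T')
    next
      case t
      then show ?thesis
        using w2 d *[OF sub(2)] *[OF sub(3)] by (auto simp: wT ws gT gs ne T')
    qed
    then show ?thesis unfolding us by simp
  qed
  \<comment> \<open>\<open>g\<close> is 0 on the first path, which is not tight, and -1 on the
    second; so it is not proportional to \<open>w - b\<close>.\<close>
  have "inner_path n p [s, i, t]" "inner_path n p [i, t, t']"
    unfolding inner_path_def using p mem t T'[OF t(1)] T'[OF t(2)] ne by auto
  from facetD[OF facet g0 tightD(2) this]
  have "(pcost g (0 # [s, i, t] @ [n]) - 0) * (pcost w (0 # [i, t, t'] @ [n]) - real b) =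
    (pcost g (0 # [i, t, t'] @ [n]) - 0) * (pcost w (0 # [s, i, t] @ [n]) - real b)" by simp
  moreover have "pcost g (0 # [s, i, t] @ [n]) = 0" "pcost g (0 # [i, t, t'] @ [n]) = -1"
    "pcost w (0 # [s, i, t] @ [n]) = 1"
    using t T'[OF t(1)] T'[OF t(2)] ne by (auto simp: wT ws gT gs)
  ultimately show False unfolding b2 by simp
qed

end

section \<open>Sufficiency of the conditions\<close>

context gmc
begin

declare [[linarith_neq_limit = 1]] \<comment> \<open>otherwise arithmetic splits the many node inequalities\<close>

text \<open>Padding that extends a tight path without creating slack.\<close>

fun alt :: "nat list \<Rightarrow> bool" where
  "alt [] \<longleftrightarrow> True"
| "alt [x] \<longleftrightarrow> False"
| "alt (s # t # Z) \<longleftrightarrow> s \<in> S' \<and> t \<in> T \<and> alt Z"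

lemma alt_exists:
  assumes "A \<subseteq> S'" "B \<subseteq> T" "m \<le> card A" "m \<le> card B"
  shows "\<exists>Z. alt Z \<and> distinct Z \<and> set Z \<subseteq> A \<union> B \<and> length Z = 2 * m"
  using assms
proof (induction m arbitrary: A B)
  case 0
  then show ?case by (intro exI[of _ "[]"]) auto
next
  case (Suc m)
  have fAB: "finite A" "finite B" using Suc.prems(1,2) fin finite_subset by blast+
  obtain s where s: "s \<in> A" using Suc.prems(3) by (metis all_not_in_conv card.empty not_less_eq_eq zero_le)
  obtain t where t: "t \<in> B" using Suc.prems(4) by (metis all_not_in_conv card.empty not_less_eq_eq zero_le)
  have "m \<le> card (A - {s})" "m \<le> card (B - {t})" "A - {s} \<subseteq> S'" "B - {t} \<subseteq> T"
    using Suc.prems s t fAB by auto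
  then obtain Z where Z: "alt Z" "distinct Z" "set Z \<subseteq> (A - {s}) \<union> (B - {t})" "length Z = 2 * m"
    using Suc.IH[of "A - {s}" "B - {t}"] by blast
  have "s \<notin> T" "t \<notin> S" using s t Suc.prems(1,2) part(4) by auto
  then show ?case
    using Z s t Suc.prems(1,2) by (intro exI[of _ "s # t # Z"]) auto
qed

lemma alt_subset: "alt Z \<Longrightarrow> set Z \<subseteq> S' \<union> T"
  by (induction Z rule: alt.induct) auto

lemma w_T [simp]: "t \<in> T \<Longrightarrow> w t v = 0"
  using memT by (auto simp: w_def)

lemma w_R [simp]: "i \<in> R \<Longrightarrow> w i v = 1"
  using memR by (auto simp: w_def)

lemma w_S: "s \<in> S \<Longrightarrow> w s v = of_bool (v \<in> T)"
  using part by (auto simp: w_def)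

lemma pcost_w_T: "t \<in> T \<Longrightarrow> pcost w (t # xs) = pcost w xs"
  by (cases xs) auto

lemma pcost_w_R: "i \<in> R \<Longrightarrow> xs \<noteq> [] \<Longrightarrow> pcost w (i # xs) = 1 + pcost w xs"
  by (cases xs) auto

lemma pcost_w_Rs: "set C \<subseteq> R \<Longrightarrow> xs \<noteq> [] \<Longrightarrow> pcost w (C @ xs) = real (length C) + pcost w xs"
  by (induction C) (auto simp: pcost_w_R)

lemma pcost_w_S_Rs: "s \<in> S \<Longrightarrow> set C \<subseteq> R \<Longrightarrow> v \<notin> T \<Longrightarrow> pcost w (s # C @ v # xs) = pcost w (C @ v # xs)"
  using memR by (cases C) (auto simp: w_S)

lemma pcost_w_alt: "alt Z \<Longrightarrow> pcost w (Z @ xs) = real (length Z div 2) + pcost w xs"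
  by (induction Z rule: alt.induct) (auto simp: w_S pcost_w_T)

lemmas pcost_w_simps = pcost_w_T pcost_w_R pcost_w_Rs pcost_w_S_Rs pcost_w_alt w_S

lemma tightI:
  assumes "distinct us" "set us \<subseteq> R \<union> S' \<union> T" "length us + 1 = p" "pcost w (0 # us @ [n]) = real b"
  shows "tight us"
  using assms inner_nodes by (auto simp: tight_def inner_path_def)

text \<open>
  Named nodes and padding for the tight paths below. The name of each lemma on a tight path spells
  out the order of its nodes: \<open>s\<close>, \<open>t\<close> for nodes of \<open>S\<close>, \<open>T\<close>, \<open>C\<close> for a list of nodes of \<open>R\<close>, \<open>Z\<close> for the padding.
\<close>

definition conf :: "nat \<Rightarrow> nat \<Rightarrow> nat \<Rightarrow> nat \<Rightarrow> nat \<Rightarrow> nat \<Rightarrow> nat list \<Rightarrow> bool" where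
  "conf k s s' t t' t'' Z \<longleftrightarrow> p = card R + 2 * k + 1 \<and> 2 \<le> k \<and> {s, s'} \<subseteq> S' \<and> {t, t', t''} \<subseteq> T \<and>
     s \<noteq> s' \<and> t \<noteq> t' \<and> t \<noteq> t'' \<and> t' \<noteq> t'' \<and> alt Z \<and> distinct Z \<and>
     set Z \<inter> {s, s', t, t', t''} = {} \<and> length Z = 2 * (k - 2)"

lemma conf_swap_T: "conf k s s' t t' t'' Z \<Longrightarrow> conf k s s' t'' t' t Z"
  unfolding conf_def by auto

lemma conf_swap_S: "conf k s s' t t' t'' Z \<Longrightarrow> conf k s' s t t' t'' Z"
  unfolding conf_def by auto

text \<open>The padding takes \<open>k - 2\<close> nodes each from S' and T besides the two and
  three named ones, so \<open>k\<close> and \<open>k + 1\<close> nodes are just enough.\<close>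

lemma conf_exists:
  assumes "p = card R + 2 * k + 1" "2 \<le> k" "k \<le> card S'" "k + 1 \<le> card T"
    and "{s, s'} \<subseteq> S'" "{t, t', t''} \<subseteq> T" "s \<noteq> s'" "t \<noteq> t'" "t \<noteq> t''" "t' \<noteq> t''"
  shows "\<exists>Z. conf k s s' t t' t'' Z"
proof -
  have "card (S' - {s, s'}) = card S' - 2"
    using assms(5,7) by (subst card_Diff_subset) (auto simp: numeral_2_eq_2)
  moreover have "card (T - {t, t', t''}) = card T - 3"
    using assms(6,8,9,10) by (subst card_Diff_subset) (auto simp: numeral_3_eq_3)
  ultimately have "k - 2 \<le> card (S' - {s, s'})" "k - 2 \<le> card (T - {t, t', t''})"
    using assms(3,4) by auto
  then obtain Z where Z: "alt Z" "distinct Z" "set Z \<subseteq> (S' - {s, s'}) \<union> (T - {t, t', t''})"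
      "length Z = 2 * (k - 2)"
    using alt_exists[of "S' - {s, s'}" "T - {t, t', t''}" "k - 2"] by blast
  have "set Z \<inter> {s, s', t, t', t''} = {}"
    using Z(3) assms(5,6) part(4) by auto
  then show ?thesis using Z assms unfolding conf_def by (intro exI[of _ Z]) simp
qed

context
  fixes k s s' t t' t'' Z C
  assumes conf: "conf k s s' t t' t'' Z" and C: "set C = R" "distinct C"
begin

lemma conf_simps:
  "s \<in> S" "s' \<in> S" "s \<noteq> 0" "s \<noteq> n" "s' \<noteq> 0" "s' \<noteq> n" "s \<notin> R" "s \<notin> T" "s' \<notin> R" "s' \<notin> T" "s \<noteq> s'" "s' \<noteq> s"
  "t \<in> T" "t' \<in> T" "t'' \<in> T" "t \<notin> R" "t' \<notin> R" "t'' \<notin> R" "t \<notin> S" "t' \<notin> S" "t'' \<notin> S"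
  "t \<noteq> t'" "t' \<noteq> t" "t \<noteq> t''" "t'' \<noteq> t" "t' \<noteq> t''" "t'' \<noteq> t'"
  "alt Z" "distinct Z" "s \<notin> set Z" "s' \<notin> set Z" "t \<notin> set Z" "t' \<notin> set Z" "t'' \<notin> set Z"
  "R \<inter> set Z = {}" "set Z \<inter> R = {}" "set Z \<subseteq> R \<union> S' \<union> T" "set C \<subseteq> R"
  "s \<noteq> t" "s \<noteq> t'" "s \<noteq> t''" "s' \<noteq> t" "s' \<noteq> t'" "s' \<noteq> t''"
  "t \<noteq> s" "t' \<noteq> s" "t'' \<noteq> s" "t \<noteq> s'" "t' \<noteq> s'" "t'' \<noteq> s'"
  "length Z div 2 = k - 2"
proof -
  have sS: "s \<in> S'" "s' \<in> S'" and T: "t \<in> T" "t' \<in> T" "t'' \<in> T"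
    and d: "s \<noteq> s'" "t \<noteq> t'" "t \<noteq> t''" "t' \<noteq> t''" "alt Z" "distinct Z"
    and Z: "set Z \<inter> {s, s', t, t', t''} = {}" "length Z = 2 * (k - 2)"
    using conf unfolding conf_def by auto
  have s: "s \<in> S" "s' \<in> S" "s \<noteq> 0" "s \<noteq> n" "s' \<noteq> 0" "s' \<noteq> n" "s \<notin> R" "s \<notin> T" "s' \<notin> R" "s' \<notin> T"
    using memS[OF sS(1)] memS[OF sS(2)] by simp_all
  have T': "t \<notin> R" "t' \<notin> R" "t'' \<notin> R" "t \<notin> S" "t' \<notin> S" "t'' \<notin> S"
    using memT[OF T(1)] memT[OF T(2)] memT[OF T(3)] by simp_all
  have Z': "set Z \<subseteq> S' \<union> T" using alt_subset[OF d(5)] .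
  then have "R \<inter> set Z = {}" using part(2,3) by blast
  then show "R \<inter> set Z = {}" "set Z \<inter> R = {}" "set Z \<subseteq> R \<union> S' \<union> T" "set C \<subseteq> R"
    using Z' C by auto
  show "s \<in> S" "s' \<in> S" "s \<noteq> 0" "s \<noteq> n" "s' \<noteq> 0" "s' \<noteq> n" "s \<notin> R" "s \<notin> T" "s' \<notin> R" "s' \<notin> T" "s \<noteq> s'" "s' \<noteq> s"
    "t \<in> T" "t' \<in> T" "t'' \<in> T" "t \<notin> R" "t' \<notin> R" "t'' \<notin> R" "t \<notin> S" "t' \<notin> S" "t'' \<notin> S"
    "t \<noteq> t'" "t' \<noteq> t" "t \<noteq> t''" "t'' \<noteq> t" "t' \<noteq> t''" "t'' \<noteq> t'"
    "alt Z" "distinct Z" "s \<notin> set Z" "s' \<notin> set Z" "t \<notin> set Z" "t' \<notin> set Z" "t'' \<notin> set Z"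
    "length Z div 2 = k - 2"
    using s T T' d Z by simp_all
  show "s \<noteq> t" "s \<noteq> t'" "s \<noteq> t''" "s' \<noteq> t" "s' \<noteq> t'" "s' \<noteq> t''"
    "t \<noteq> s" "t' \<noteq> s" "t'' \<noteq> s" "t \<noteq> s'" "t' \<noteq> s'" "t'' \<noteq> s'"
    using s(8,10) T by blast+
qed

lemma conf_length: "length C = card R" "length Z + 4 = 2 * k" "p = card R + 2 * k + 1" "b = card R + k" "2 \<le> k"
proof -
  have Z: "length Z = 2 * (k - 2)" using conf unfolding conf_def by simp
  show p: "p = card R + 2 * k + 1" and k: "2 \<le> k"
    using conf unfolding conf_def by simp_all
  show "length Z + 4 = 2 * k" using Z k by linarith
  show "length C = card R" using C distinct_card[of C] by simp
  have "(p + card R) div 2 = card R + k" using p by simp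
  then show "b = card R + k" by (simp only: b_def)
qed

lemmas conf_tight = conf_simps conf_length(1,4,5) C pcost_w_simps ends mem0

text \<open>In this and the next orders exactly one unit of slack occurs: an arc leaving S outside
  T, here from \<open>s\<close> to \<open>s'\<close>, or one entering T from outside S, such as
  \<open>t''\<close> to \<open>t\<close>. Nonempty padding begins in S' and ends in T, so it can
  follow T or R for free.\<close>

lemma tight_tsstCZ: "tight ([t, s, s', t'] @ C @ Z)"
  by (rule tightI) (simp add: conf_simps C, (auto simp: conf_simps C)[1], use conf_length in simp, simp add: conf_tight)

lemma tight_tCsstZ: "tight (t # C @ [s, s', t'] @ Z)"
  by (rule tightI) (simp add: conf_simps C, (auto simp: conf_simps C)[1], use conf_length in simp, simp add: conf_tight)

lemma tight_ststCZ: "tight ([s, t, s', t'] @ C @ Z)"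
  by (rule tightI) (simp add: conf_simps C, (auto simp: conf_simps C)[1], use conf_length in simp, simp add: conf_tight)

lemma tight_stZCst: "tight ([s', t'] @ Z @ C @ [s, t])"
  by (rule tightI) (simp add: conf_simps C, (auto simp: conf_simps C)[1], use conf_length in simp, simp add: conf_tight)

lemma tight_ttstCZ: "tight ([t'', t, s, t'] @ C @ Z)"
  by (rule tightI) (simp add: conf_simps C, (auto simp: conf_simps C)[1], use conf_length in simp, simp add: conf_tight)

lemma tight_ttCstZ: "tight ([t'', t] @ C @ [s, t'] @ Z)"
  by (rule tightI) (simp add: conf_simps C, (auto simp: conf_simps C)[1], use conf_length in simp, simp add: conf_tight)

lemma tight_stCstZ: "tight ([s', t] @ C @ [s, t'] @ Z)"
  by (rule tightI) (simp add: conf_simps C, (auto simp: conf_simps C)[1], use conf_length in simp, simp add: conf_tight)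

lemma tight_tCstZs: "tight (t # C @ [s, t'] @ Z @ [s'])"
  by (rule tightI) (simp add: conf_simps C, (auto simp: conf_simps C)[1], use conf_length in simp, simp add: conf_tight)

lemma tight_tsCstZ: "tight ([t, s'] @ C @ [s, t'] @ Z)"
  by (rule tightI) (simp add: conf_simps C, (auto simp: conf_simps C)[1], use conf_length in simp, simp add: conf_tight)

lemma tight_CststZ: "tight (C @ [s, t, s', t'] @ Z)"
  by (rule tightI) (simp add: conf_simps C, (auto simp: conf_simps C)[1], use conf_length in simp, simp add: conf_tight)

lemma tight_tCtstZ: "tight (t # C @ [t'', s, t'] @ Z)"
  by (rule tightI) (simp add: conf_simps C, (auto simp: conf_simps C)[1], use conf_length in simp, simp add: conf_tight)

lemma tight_ttZstC: "tight ([t'', t] @ Z @ [s, t'] @ C)"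
  by (rule tightI) (simp add: conf_simps C, (auto simp: conf_simps C)[1], use conf_length in simp, simp add: conf_tight)

end

text \<open>Compared with \<open>tight_ttCstZ\<close> for \<open>i # j # C\<close>, the rest of R
  moves behind \<open>Z\<close> and only \<open>i\<close> stays, which isolates the arc from
  \<open>i\<close> to \<open>j\<close>.\<close>

lemma tight_ttistZjC:
  assumes "conf k s s' t t' t'' Z" "set C = R - {i, j}" "distinct C" "i \<in> R" "j \<in> R" "i \<noteq> j"
  shows "tight ([t'', t, i, s, t'] @ Z @ j # C)"
proof -
  have C: "set (i # j # C) = R" "distinct (i # j # C)" using assms(2-6) by auto
  note cs = conf_simps[OF assms(1) C]
  have len: "card R = length C + 2" using conf_length(1)[OF assms(1) C] by simp
  have ij: "i \<notin> T" "j \<notin> T" "i \<notin> set Z" "j \<notin> set Z" "i \<noteq> s" "i \<noteq> t" "i \<noteq> t'" "i \<noteq> t''"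
    "j \<noteq> s" "j \<noteq> t" "j \<noteq> t'" "j \<noteq> t''" "s \<noteq> j" "t \<noteq> j" "t' \<noteq> j" "t'' \<noteq> j"
    "set Z \<inter> set C = {}" "set C \<subseteq> R"
    using memR[OF assms(4)] memR[OF assms(5)] cs(7,16-18,35) assms(2,4,5) by auto
  show ?thesis
  proof (rule tightI)
    show "distinct ([t'', t, i, s, t'] @ Z @ j # C)"
      using ij assms(2,3,6) by (simp add: cs)
    show "set ([t'', t, i, s, t'] @ Z @ j # C) \<subseteq> R \<union> S' \<union> T"
      using assms(4,5) ij(18) cs(1-6,13-15,37) by auto
    show "length ([t'', t, i, s, t'] @ Z @ j # C) + 1 = p"
      using conf_length[OF assms(1) C] by simp
    show "pcost w (0 # ([t'', t, i, s, t'] @ Z @ j # C) @ [n]) = real b"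
      using conf_length(5)[OF assms(1) C] assms(4,5) ij
      by (simp add: cs len conf_length(4)[OF assms(1) C] pcost_w_simps ends mem0)
  qed
qed

text \<open>The slack is spent on omitting \<open>i\<close>, which makes room for \<open>s'\<close>
  and so for one more arc from S to T.\<close>

lemma tight_tCststZ:
  assumes "conf k s s' t t' t'' Z" "set C = R - {i}" "distinct C" "i \<in> R"
  shows "tight (t # C @ [s, t', s', t''] @ Z)"
proof -
  have C: "set (i # C) = R" "distinct (i # C)" using assms(2-4) by auto
  note cs = conf_simps[OF assms(1) C]
  have len: "card R = length C + 1" using conf_length(1)[OF assms(1) C] by simp
  have CR: "set C \<subseteq> R" "set C \<inter> set Z = {}" using assms(2) cs(35) by auto
  show ?thesis
  proof (rule tightI)
    show "distinct (t # C @ [s, t', s', t''] @ Z)"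
      using assms(2,3) CR by (simp add: cs)
    show "set (t # C @ [s, t', s', t''] @ Z) \<subseteq> R \<union> S' \<union> T"
      using CR cs(1-6,13-15,37) by auto
    show "length (t # C @ [s, t', s', t''] @ Z) + 1 = p"
      using conf_length[OF assms(1) C] by simp
    show "pcost w (0 # (t # C @ [s, t', s', t''] @ Z) @ [n]) = real b"
      using conf_length(5)[OF assms(1) C] CR
      by (simp add: cs len conf_length(4)[OF assms(1) C] pcost_w_simps ends mem0)
  qed
qed

end

section \<open>Costs constant on tight paths: the case p >= |R| + 5\<close>

context gmc
begin

text \<open>Adding a constant and a potential difference changes all path costs by the same amount.\<close>

lemma normalize:
  assumes "s0 \<in> S'" "t0 \<in> T"
  obtains c d f where "\<And>u v. c u v = c0 u v + (d + (f u - f v))"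
    "\<And>v. v \<in> S' \<union> R \<union> {n} \<Longrightarrow> c t0 v = 0" "\<And>t. t \<in> T \<Longrightarrow> c t n = 0"
    "c 0 s0 = 0" "c 0 t0 = (c s0 t0 :: real)"
proof -
  \<comment> \<open>With \<open>f t0 = 0\<close>, the conditions on arcs leaving T and on the arc
    from 0 to \<open>s0\<close> determine \<open>f\<close>; \<open>d\<close> is what
    \<open>c 0 t0 = c s0 t0\<close> then requires.\<close>
  define d where "d = c0 0 t0 - c0 s0 t0 - c0 0 s0"
  define f where "f v = (if v \<in> T then c0 t0 n - c0 v n else if v = 0 then c0 t0 s0 - c0 0 s0 else c0 t0 v + d)" for v
  define c where "c u v = c0 u v + (d + (f u - f v))" for u v
  have f: "f v = c0 t0 v + d" if "v \<in> S' \<union> R \<union> {n}" for v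
  proof -
    have "v \<notin> T" using that part(3,4) ends by blast
    moreover have "v \<noteq> 0" using that part(2) ends pn by auto
    ultimately show ?thesis by (simp add: f_def)
  qed
  have fT: "f t = c0 t0 n - c0 t n" if "t \<in> T" for t using that by (simp add: f_def)
  have f0: "f 0 = c0 t0 s0 - c0 0 s0" using mem0 by (simp add: f_def)
  show ?thesis
  proof (rule that[of c d f])
    show "c t0 v = 0" if "v \<in> S' \<union> R \<union> {n}" for v
      unfolding c_def using f[OF that] fT[OF assms(2)] by simp
    show "c t n = 0" if "t \<in> T" for t
      unfolding c_def using f[of n] fT[OF that] by simp
    show "c 0 s0 = 0" "c 0 t0 = c s0 t0"
      unfolding c_def using f[of s0] f0 fT[OF assms(2)] assms(1) by (simp_all add: d_def)
  qed (simp add: c_def)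
qed

lemma list_of_R: "\<exists>C. set C = R - X \<and> distinct C"
  using finite_distinct_list[of "R - X"] fin by blast

text \<open>The premises are the values of \<open>a * w\<close> sorted by the classes of tail and
  head, to be established one pair of classes at a time.\<close>

lemma eq_on_arcsI:
  assumes "\<And>v. v \<in> T \<Longrightarrow> c 0 v = a" "\<And>v. v \<in> S' \<union> R \<Longrightarrow> c 0 v = 0"
    and "\<And>s v. s \<in> S' \<Longrightarrow> v \<in> T \<Longrightarrow> c s v = a" "\<And>s v. s \<in> S' \<Longrightarrow> v \<in> S' \<union> R \<union> {n} \<Longrightarrow> s \<noteq> v \<Longrightarrow> c s v = 0"
    and "\<And>t v. t \<in> T \<Longrightarrow> v \<in> T \<union> S' \<union> R \<union> {n} \<Longrightarrow> t \<noteq> v \<Longrightarrow> c t v = 0"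
    and "\<And>i v. i \<in> R \<Longrightarrow> v \<in> T \<union> S' \<union> R \<union> {n} \<Longrightarrow> i \<noteq> v \<Longrightarrow> c i v = a"
    and "(u, v) \<in> arcs n"
  shows "c u v = a * w u v"
proof -
  have ne: "u \<noteq> v" "(u, v) \<noteq> (0, n)" and uv: "u = 0 \<or> u \<in> {0<..<n}" "v = n \<or> v \<in> {0<..<n}"
    using assms(7) by (auto simp: arcs_def le_less)
  have "v \<in> T \<or> v \<in> S' \<union> R \<union> {n}" "v \<in> T \<union> S' \<union> R \<union> {n}"
    using uv(2)[unfolded inner_nodes] by blast+
  moreover have "v \<in> S' \<union> R \<union> {n} \<Longrightarrow> u = 0 \<Longrightarrow> v \<in> S' \<union> R"
    using ne(2) by blast
  ultimately consider "u = 0" "v \<in> T" | "u = 0" "v \<in> S' \<union> R" | "u \<in> S'" "v \<in> T" | "u \<in> S'" "v \<in> S' \<union> R \<union> {n}"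
    | "u \<in> T" "v \<in> T \<union> S' \<union> R \<union> {n}" | "u \<in> R" "v \<in> T \<union> S' \<union> R \<union> {n}"
    using uv(1)[unfolded inner_nodes] by blast
  then show ?thesis
  proof cases
    case 1
    then show ?thesis using assms(1) ends by (simp add: w_S)
  next
    case 2
    then have "v \<notin> T" using part(3,4) by blast
    then show ?thesis using 2 assms(2) ends by (simp add: w_S)
  next
    case 3
    then show ?thesis using assms(3) by (simp add: w_S)
  next
    case 4
    then have "v \<notin> T" using part(3,4) ends by blast
    then show ?thesis using 4 assms(4)[OF 4 ne(1)] by (simp add: w_S)
  next
    case 5
    then show ?thesis using assms(5)[OF 5 ne(1)] by simp
  next
    case 6
    then show ?thesis using assms(6)[OF 6 ne(1)] by simp
  qed
qed

context
  fixes c :: "nat \<Rightarrow> nat \<Rightarrow> real" and \<beta> :: real and k s0 t0 :: nat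
  assumes H: "\<And>us. tight us \<Longrightarrow> pcost c (0 # us @ [n]) = \<beta>"
    and k: "p = card R + 2 * k + 1" "2 \<le> k" "k \<le> card S'" "k + 1 \<le> card T"
    and s0: "s0 \<in> S'" and t0: "t0 \<in> T"
    and nt0: "\<And>v. v \<in> S' \<union> R \<union> {n} \<Longrightarrow> c t0 v = 0"
    and nTn: "\<And>t. t \<in> T \<Longrightarrow> c t n = 0"
    and n0: "c 0 s0 = 0" "c 0 t0 = c s0 t0"
begin

lemma other_S: obtains s' where "s' \<in> S'" "s' \<noteq> s"
proof -
  have "card S' \<ge> 2" using k by simp
  then show ?thesis using two_elements[of S'] that by metis
qed

lemma other_T: obtains t' where "t' \<in> T" "t' \<noteq> t" "t' \<noteq> t''"
proof -
  have "T - {t, t''} \<noteq> {}"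
  proof
    assume "T - {t, t''} = {}"
    then have "T \<subseteq> {t, t''}" by blast
    then have "card T \<le> card {t, t''}" by (intro card_mono) auto
    also have "\<dots> \<le> 2" by (simp add: card_insert_if)
    finally show False using k by simp
  qed
  then show ?thesis using that by blast
qed

lemma conf_ex:
  assumes "s \<in> S'" "s' \<in> S'" "t \<in> T" "t' \<in> T" "t'' \<in> T" "s \<noteq> s'" "t \<noteq> t'" "t \<noteq> t''" "t' \<noteq> t''"
  obtains Z where "conf k s s' t t' t'' Z"
proof -
  have "\<exists>Z. conf k s s' t t' t'' Z"
    by (rule conf_exists[OF k]) (use assms in simp_all)
  then show ?thesis using that by blast
qed

text \<open>\<open>t''\<close> is off the path, so exchanging \<open>t\<close> for it changes only
  the two arcs at \<open>t\<close>. The next three lemmas do the same with other neighbours of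
  \<open>t\<close>.\<close>

lemma swap_T_0S:
  assumes "t \<in> T" "t'' \<in> T" "t \<noteq> t''" "s \<in> S'"
  shows "c 0 t + c t s = c 0 t'' + c t'' s"
proof -
  obtain s' where s': "s' \<in> S'" "s' \<noteq> s" by (rule other_S)
  obtain t' where t': "t' \<in> T" "t' \<noteq> t" "t' \<noteq> t''" by (rule other_T)
  obtain Z where Z: "conf k s s' t t' t'' Z"
    by (rule conf_ex[of s s' t t' t'']) (use assms s' t' in auto)
  obtain C where C: "set C = R" "distinct C" using list_of_R[of "{}"] by auto
  show ?thesis
    using H[OF tight_tsstCZ[OF Z C]] H[OF tight_tsstCZ[OF conf_swap_T[OF Z] C]] by simp
qed

lemma swap_T_0R:
  assumes "t \<in> T" "t'' \<in> T" "t \<noteq> t''" "i \<in> R"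
  shows "c 0 t + c t i = c 0 t'' + c t'' i"
proof -
  obtain s' where s': "s' \<in> S'" "s' \<noteq> s0" by (rule other_S)
  obtain t' where t': "t' \<in> T" "t' \<noteq> t" "t' \<noteq> t''" by (rule other_T)
  obtain Z where Z: "conf k s0 s' t t' t'' Z"
    by (rule conf_ex[of s0 s' t t' t'']) (use assms s' t' s0 in auto)
  obtain C where "set C = R - {i}" "distinct C" using list_of_R[of "{i}"] by blast
  then have C: "set (i # C) = R" "distinct (i # C)" using assms(4) by auto
  show ?thesis
    using H[OF tight_tCsstZ[OF Z C]] H[OF tight_tCsstZ[OF conf_swap_T[OF Z] C]] by simp
qed

lemma swap_T_SS:
  assumes "t \<in> T" "t'' \<in> T" "t \<noteq> t''" "s \<in> S'" "s' \<in> S'" "s \<noteq> s'"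
  shows "c s t + c t s' = c s t'' + c t'' s'"
proof -
  obtain t' where t': "t' \<in> T" "t' \<noteq> t" "t' \<noteq> t''" by (rule other_T)
  obtain Z where Z: "conf k s s' t t' t'' Z"
    by (rule conf_ex[of s s' t t' t'']) (use assms t' in auto)
  obtain C where C: "set C = R" "distinct C" using list_of_R[of "{}"] by auto
  show ?thesis
    using H[OF tight_ststCZ[OF Z C]] H[OF tight_ststCZ[OF conf_swap_T[OF Z] C]] by simp
qed

lemma swap_T_Sn:
  assumes "t \<in> T" "t'' \<in> T" "t \<noteq> t''" "s \<in> S'"
  shows "c s t = c s t''"
proof -
  obtain s' where s': "s' \<in> S'" "s' \<noteq> s" by (rule other_S)
  obtain t' where t': "t' \<in> T" "t' \<noteq> t" "t' \<noteq> t''" by (rule other_T)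
  obtain Z where Z: "conf k s s' t t' t'' Z"
    by (rule conf_ex[of s s' t t' t'']) (use assms s' t' in auto)
  obtain C where C: "set C = R" "distinct C" using list_of_R[of "{}"] by auto
  have split: "pcost c (0 # ([s', t'] @ Z @ C @ [s, x]) @ [n]) = pcost c (0 # s' # t' # Z @ C @ [s]) + c s x + c x n" for x
    using pcost_append[of c "0 # s' # t' # Z @ C" s "[x, n]"] by simp
  show ?thesis
    using H[OF tight_stZCst[OF Z C]] H[OF tight_stZCst[OF conf_swap_T[OF Z] C]] nTn[OF assms(1)] nTn[OF assms(2)]
    unfolding split by simp
qed

text \<open>The exchange before \<open>n\<close> makes \<open>c s t\<close> independent of
  \<open>t\<close>, as \<open>c t n = 0\<close>. Then the exchange between two nodes of S' settles
  the arcs from \<open>t\<close> to S', the one between 0 and S' settles \<open>c 0 t\<close>, and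
  the one between 0 and R the arcs from \<open>t\<close> to R.\<close>

lemma cost_T:
  assumes "t \<in> T" "v \<in> S' \<union> R \<union> {n}"
  shows "c t v = 0"
proof (cases "t = t0")
  case True
  then show ?thesis using nt0 assms by simp
next
  case False
  have 0: "c 0 t = c 0 t0" if "s \<in> S'" "c t s = 0" for s
    using swap_T_0S[OF assms(1) t0 False that(1)] that nt0 by simp
  have S0: "c t s = 0" if s: "s \<in> S'" for s
  proof -
    obtain s' where s': "s' \<in> S'" "s' \<noteq> s" by (rule other_S)
    show ?thesis
      using swap_T_SS[OF assms(1) t0 False s'(1) s s'(2)] swap_T_Sn[OF assms(1) t0 False s'(1)] nt0 s by simp
  qed
  moreover have "c t i = 0" if "i \<in> R" for i
    using swap_T_0R[OF assms(1) t0 False that] 0[OF s0 S0[OF s0]] nt0 that by simp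
  ultimately show ?thesis using assms nTn by blast
qed

lemma cost_0T: "t \<in> T \<Longrightarrow> c 0 t = c 0 t0"
  using swap_T_0S[of t t0 s0] t0 s0 cost_T[of t s0] cost_T[of t0 s0] by (cases "t = t0") auto

text \<open>\<open>s\<close> and \<open>s0\<close> are exchanged between two nodes of T; the arcs
  entering them are free by \<open>cost_T\<close>, so the arcs leaving them agree.\<close>

lemma cost_ST:
  assumes "s \<in> S'" "t \<in> T"
  shows "c s t = c 0 t0"
proof -
  have "c s t0 = c s0 t0"
  proof (cases "s = s0")
    case False
    obtain t where t: "t \<in> T" "t \<noteq> t0" "t \<noteq> t0" by (rule other_T)
    obtain t'' where t'': "t'' \<in> T" "t'' \<noteq> t" "t'' \<noteq> t0" by (rule other_T)
    obtain Z where Z: "conf k s s0 t t0 t'' Z"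
      by (rule conf_ex[of s s0 t t0 t'']) (use assms(1) False s0 t0 t t'' in auto)
    obtain C where C: "set C = R" "distinct C" using list_of_R[of "{}"] by auto
    show ?thesis
      using H[OF tight_ttstCZ[OF Z C]] H[OF tight_ttstCZ[OF conf_swap_S[OF Z] C]]
        cost_T[OF t(1), of s] cost_T[OF t(1), of s0] assms(1) s0 by simp
  qed simp
  moreover have "c s t = c s t0"
    using swap_T_Sn[OF assms(2) t0 _ assms(1)] by (cases "t = t0") auto
  ultimately show ?thesis using n0 by simp
qed

text \<open>Arcs from T to nodes outside T are now free, so nodes of T can be skipped when paths are
  evaluated.\<close>

lemma erase_T:
  assumes "t \<in> T"
  shows "v \<in> S' \<union> R \<union> {n} \<Longrightarrow> pcost c (t # v # xs) = pcost c (v # xs)"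
    and "set C \<subseteq> R \<Longrightarrow> v \<in> S' \<union> R \<union> {n} \<Longrightarrow> pcost c (t # C @ v # xs) = pcost c (C @ v # xs)"
proof -
  show 1: "v \<in> S' \<union> R \<union> {n} \<Longrightarrow> pcost c (t # v # xs) = pcost c (v # xs)" for v xs
    using cost_T[OF assms] by simp
  show "set C \<subseteq> R \<Longrightarrow> v \<in> S' \<union> R \<union> {n} \<Longrightarrow> pcost c (t # C @ v # xs) = pcost c (C @ v # xs)"
    using 1 by (cases C) auto
qed

text \<open>Padding behind a node of T is entered and left by arcs with tail in T, which are free;
  so its cost does not depend on its place and cancels in comparisons.\<close>

lemma pcost_alt:
  assumes "alt Z" "t \<in> T" "v \<in> S' \<union> R \<union> {n}"
  shows "pcost c (t # Z @ v # xs) = pcost c Z + pcost c (v # xs)"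
  using assms(1,2)
proof (induction Z arbitrary: t rule: alt.induct)
  case 1
  then show ?case using erase_T(1) assms(3) by simp
next
  case (3 s t' Z)
  then have "pcost c (t' # Z @ v # xs) = pcost c Z + pcost c (v # xs)" "c t s = 0"
    using cost_T[of t s] by auto
  moreover have "pcost c (t' # Z) = pcost c Z"
    using 3 cost_T[of t'] by (cases Z rule: alt.cases) auto
  ultimately show ?case by simp
qed simp

lemma pcost_split: "pcost c (xs @ y # z # zs) = pcost c (xs @ [y]) + pcost c (y # z # zs)"
  by (rule pcost_append)

lemmas path_eval = erase_T pcost_alt pcost_split cost_ST

lemma config:
  assumes "s \<in> S'" "s' \<in> S'" "s \<noteq> s'" "t \<in> T" "t'' \<in> T" "t \<noteq> t''"
  obtains t' Z where "conf k s s' t t' t'' Z" "t' \<in> T" "alt Z"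
proof -
  obtain t' where t': "t' \<in> T" "t' \<noteq> t" "t' \<noteq> t''" by (rule other_T)
  obtain Z where Z: "conf k s s' t t' t'' Z"
    by (rule conf_ex[of s s' t t' t'']) (use assms t' in auto)
  moreover have "alt Z" using Z by (simp add: conf_def)
  ultimately show ?thesis using that t'(1) by blast
qed

text \<open>Replacing the first node \<open>t''\<close> by \<open>s'\<close> moves the slack from
  the arc \<open>t''\<close> to \<open>t\<close> onto the arc 0 to \<open>s'\<close>; the arcs 0 to
  \<open>t''\<close> and \<open>s'\<close> to \<open>t\<close> cost the same.\<close>

lemma cost_TT_0S:
  assumes "s' \<in> S'" "t \<in> T" "t'' \<in> T" "t \<noteq> t''"
  shows "c t'' t = c 0 s'"
proof -
  obtain s where s: "s \<in> S'" "s \<noteq> s'" by (rule other_S)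
  obtain t' Z where Z: "conf k s s' t t' t'' Z" "t' \<in> T" "alt Z"
    by (rule config[OF s(1) assms(1) s(2) assms(2,3,4)])
  obtain C where C: "set C = R" "distinct C" using list_of_R[of "{}"] by auto
  show ?thesis
    using H[OF tight_ttCstZ[OF Z(1) C]] H[OF tight_stCstZ[OF Z(1) C]]
    by (simp add: path_eval cost_0T[OF assms(3)] assms(2,3) memS[OF assms(1)] memS[OF s(1)] Z(2,3) C(1))
qed

lemma cost_0S:
  assumes "s \<in> S'"
  shows "c 0 s = 0"
proof -
  obtain t where t: "t \<in> T" "t \<noteq> t0" "t \<noteq> t0" by (rule other_T)
  show ?thesis
    using cost_TT_0S[OF assms t(1) t0 t(2)] cost_TT_0S[OF s0 t(1) t0 t(2)] n0(1) by simp
qed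

lemma cost_TT:
  assumes "t \<in> T" "t'' \<in> T" "t \<noteq> t''"
  shows "c t t'' = 0"
  using cost_TT_0S[OF s0 assms(2,1) assms(3)[symmetric]] n0(1) by simp

text \<open>\<open>s'\<close> is placed so that its arc, or for \<open>c s s'\<close> the arc
  entering it, carries the slack, while the comparison path spends its slack on an arc already known
  to be free.\<close>

lemma cost_S:
  assumes "s' \<in> S'"
  shows "c s' n = 0" "s \<in> S' \<Longrightarrow> s \<noteq> s' \<Longrightarrow> c s s' = 0" "i \<in> R \<Longrightarrow> c s' i = 0"
proof -
  obtain t where t: "t \<in> T" "t \<noteq> t0" "t \<noteq> t0" by (rule other_T)
  obtain s where s: "s \<in> S'" "s \<noteq> s'" by (rule other_S)
  obtain C where C: "set C = R" "distinct C" using list_of_R[of "{}"] by auto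
  obtain t' Z where Z: "conf k s s' t t' t0 Z" "t' \<in> T" "alt Z"
    by (rule config[OF s(1) assms(1) s(2) t(1) t0 t(2)])
  show "c s' n = 0"
    using H[OF tight_tCstZs[OF Z(1) C]] H[OF tight_stCstZ[OF Z(1) C]]
    by (simp add: path_eval cost_0T[OF t(1)] cost_0S memS[OF assms] memS[OF s(1)] Z(2,3) t(1) C(1))
  show "c s' i = 0" if i: "i \<in> R"
  proof -
    obtain C where "set C = R - {i}" "distinct C" using list_of_R[of "{i}"] by blast
    then have C: "set (i # C) = R" "distinct (i # C)" using i by auto
    have "set C \<subseteq> R" using C by auto
    then show ?thesis
      using H[OF tight_tsCstZ[OF Z(1) C]] H[OF tight_ttCstZ[OF Z(1) C]] pcost_split[of "i # C" s]
      by (simp add: path_eval cost_0T[OF t(1)] memS[OF assms] memS[OF s(1)] Z(2,3) t(1) t0 i cost_T cost_TT[OF t0 t(1) t(2)[symmetric]])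
  qed
  show "c s s' = 0" if s: "s \<in> S'" "s \<noteq> s'" for s
  proof -
    obtain t' Z where Z: "conf k s s' t t' t0 Z" "t' \<in> T" "alt Z"
      by (rule config[OF s(1) assms(1) s(2) t(1) t0 t(2)])
    show ?thesis
      using H[OF tight_tCsstZ[OF Z(1) C]] H[OF tight_stCstZ[OF Z(1) C]]
      by (simp add: path_eval cost_0T[OF t(1)] cost_0S memS[OF assms] memS[OF s(1)] Z(2,3) t(1) C(1))
  qed
qed

text \<open>Slack on an arc from 0 into R is compared with slack on the arc from 0 to
  \<open>s0\<close>, which is free by normalization.\<close>

lemma cost_0R:
  assumes "i \<in> R"
  shows "c 0 i = 0"
proof -
  obtain t where t: "t \<in> T" "t \<noteq> t0" "t \<noteq> t0" by (rule other_T)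
  obtain s where s: "s \<in> S'" "s \<noteq> s0" by (rule other_S)
  obtain t' Z where Z: "conf k s s0 t t' t0 Z" "t' \<in> T" "alt Z"
    by (rule config[OF s(1) s0 s(2) t(1) t0 t(2)])
  obtain C where "set C = R - {i}" "distinct C" using list_of_R[of "{i}"] by blast
  then have C: "set (i # C) = R" "distinct (i # C)" using assms by auto
  show ?thesis
    using H[OF tight_CststZ[OF Z(1) C]] H[OF tight_stCstZ[OF Z(1) C]] pcost_split[of "i # C" s]
    by (simp add: path_eval n0(1) memS[OF s(1)] memS[OF s0] Z(2,3) t(1) assms cost_T)
qed

lemma cost_RT_RS:
  assumes "j \<in> R" "t'' \<in> T" "s \<in> S'"
  shows "c j t'' = c j s" "c j n = c j s"
proof -
  obtain t where t: "t \<in> T" "t \<noteq> t''" "t \<noteq> t''" by (rule other_T)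
  obtain s' where s': "s' \<in> S'" "s' \<noteq> s" by (rule other_S)
  obtain t' Z where Z: "conf k s s' t t' t'' Z" "t' \<in> T" "alt Z"
    by (rule config[OF assms(3) s'(1) s'(2)[symmetric] t(1) assms(2) t(2)])
  obtain C where "set C = R - {j}" "distinct C" using list_of_R[of "{j}"] by blast
  \<comment> \<open>With \<open>j\<close> last in the list, its successor is \<open>t''\<close>,
    \<open>s\<close> or \<open>n\<close>, depending on where the list is inserted.\<close>
  then have C: "set (C @ [j]) = R" "distinct (C @ [j])" "set C \<subseteq> R" using assms by auto
  show "c j t'' = c j s"
    using H[OF tight_tCtstZ[OF Z(1) C(1,2)]] H[OF tight_ttCstZ[OF Z(1) C(1,2)]]
    by (simp add: path_eval cost_0T[OF t(1)] cost_0T[OF assms(2)] assms(1,2) memS[OF assms(3)] memS[OF s'(1)] Z(2,3) t(1) C(3) cost_TT[OF assms(2) t(1) t(2)[symmetric]] cost_T)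
  show "c j n = c j s"
    using H[OF tight_ttZstC[OF Z(1) C(1,2)]] H[OF tight_ttCstZ[OF Z(1) C(1,2)]]
    by (simp add: path_eval cost_0T[OF t(1)] cost_0T[OF assms(2)] assms(1,2) memS[OF assms(3)] memS[OF s'(1)] Z(2,3) t(1) C(3) cost_TT[OF assms(2) t(1) t(2)[symmetric]] cost_T)
qed

lemma pcost_last_cong:
  "(\<And>u. u \<in> set (x # xs) \<Longrightarrow> c u y = c u z) \<Longrightarrow> pcost c (x # xs @ [y]) = pcost c (x # xs @ [z])"
  by (induction xs arbitrary: x) auto

text \<open>In the comparison path \<open>i\<close> is followed by \<open>s0\<close> instead of
  \<open>j\<close>, and the other nodes of R end at \<open>n\<close> instead of \<open>s0\<close>;
  the latter changes nothing by \<open>cost_RT_RS\<close>.\<close>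

lemma cost_RR:
  assumes "i \<in> R" "j \<in> R" "i \<noteq> j"
  shows "c i j = c i n"
proof -
  obtain t where t: "t \<in> T" "t \<noteq> t0" "t \<noteq> t0" by (rule other_T)
  obtain s' where s': "s' \<in> S'" "s' \<noteq> s0" by (rule other_S)
  obtain t' Z where Z: "conf k s0 s' t t' t0 Z" "t' \<in> T" "alt Z"
    by (rule config[OF s0 s'(1) s'(2)[symmetric] t(1) t0 t(2)])
  obtain C where C: "set C = R - {i, j}" "distinct C" using list_of_R[of "{i, j}"] by blast
  then have C': "set (i # j # C) = R" "distinct (i # j # C)" using assms by auto
  have "pcost c (j # C @ [n]) = pcost c (j # C @ [s0])"
    by (rule pcost_last_cong) (use C(1) assms(2) cost_RT_RS(2)[OF _ t0 s0] in auto)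
  then show ?thesis
    using H[OF tight_ttistZjC[OF Z(1) C assms]] H[OF tight_ttCstZ[OF Z(1) C']]
      pcost_split[of "j # C" s0] cost_RT_RS(2)[OF assms(1) t0 s0]
    by (simp add: path_eval cost_0T[OF t(1)] memS[OF s0] Z(2,3) t(1) t0 assms(1,2) cost_T)
qed

text \<open>Paths through all of R leave \<open>i\<close> exactly once, so they cannot detect the
  common cost of doing so. A path omitting \<open>i\<close> has one more arc from S to T instead,
  which fixes that cost.\<close>

lemma cost_R:
  assumes "i \<in> R" "v \<in> T \<union> S' \<union> R \<union> {n}" "i \<noteq> v"
  shows "c i v = c 0 t0"
proof -
  have eq: "c i v = c i n" if "v \<in> T \<union> S' \<union> R \<union> {n}" "i \<noteq> v" for v
    using that cost_RT_RS[OF assms(1) _ s0, of v] cost_RT_RS[OF assms(1) t0, of v]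
      cost_RT_RS(2)[OF assms(1) t0 s0] cost_RR[OF assms(1), of v] by auto
  obtain t where t: "t \<in> T" "t \<noteq> t0" "t \<noteq> t0" by (rule other_T)
  obtain s' where s': "s' \<in> S'" "s' \<noteq> s0" by (rule other_S)
  obtain t' Z where Z: "conf k s0 s' t t' t0 Z" "t' \<in> T" "alt Z"
    by (rule config[OF s0 s'(1) s'(2)[symmetric] t(1) t0 t(2)])
  obtain C where C: "set C = R - {i}" "distinct C" using list_of_R[of "{i}"] by blast
  then have C': "set (i # C) = R" "distinct (i # C)" "set C \<subseteq> R" using assms by auto
  have "i \<noteq> s0" using memR[OF assms(1)] s0 by blast
  \<comment> \<open>\<open>hd (C @ [s0])\<close> is the successor of \<open>i\<close>, also when
    \<open>C\<close> is empty.\<close>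
  then have "pcost c (i # C @ s0 # xs) = c i n + pcost c (C @ s0 # xs)" for xs
    using eq[of "hd (C @ [s0])"] C'(2,3) s0 by (cases C) auto
  then have "c i n = c 0 t0"
    using H[OF tight_tCststZ[OF Z(1) C assms(1)]] H[OF tight_ttCstZ[OF Z(1) C'(1,2)]]
    by (simp add: path_eval cost_0T[OF t(1)] memS[OF s'(1)] memS[OF s0] Z(2,3) t(1) t0 assms(1) C'(3) cost_T cost_TT[OF t0 t(1) t(2)[symmetric]])
  then show ?thesis using eq assms by simp
qed

lemma normalized_cost_ge2: "(u, v) \<in> arcs n \<Longrightarrow> c u v = c 0 t0 * w u v"
proof (rule eq_on_arcsI)
  show "c 0 v = c 0 t0" if "v \<in> T" for v by (rule cost_0T[OF that])
  show "c 0 v = 0" if "v \<in> S' \<union> R" for v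
    using that by (rule UnE) (simp_all only: cost_0S cost_0R)
  show "c s v = c 0 t0" if "s \<in> S'" "v \<in> T" for s v by (rule cost_ST[OF that])
  show "c s v = 0" if "s \<in> S'" "v \<in> S' \<union> R \<union> {n}" "s \<noteq> v" for s v
    using that(2) cost_S(1)[OF that(1)] cost_S(2)[OF _ that(1,3)] cost_S(3)[OF that(1)]
    by (elim UnE singletonE) (simp_all only:)
  show "c t v = 0" if "t \<in> T" "v \<in> T \<union> S' \<union> R \<union> {n}" "t \<noteq> v" for t v
  proof (cases "v \<in> T")
    case False
    then show ?thesis using that(2) by (intro cost_T[OF that(1)]) simp
  qed (use cost_TT[OF that(1) _ that(3)] in simp)
  show "c i v = c 0 t0" if "i \<in> R" "v \<in> T \<union> S' \<union> R \<union> {n}" "i \<noteq> v" for i v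
    by (rule cost_R[OF that])
qed

end

end

section \<open>Costs constant on tight paths: the case p = |R| + 3\<close>

context gmc
begin

context
  fixes s t t' :: nat and C1 C2 :: "nat list"
  assumes p3: "p = card R + 3" and s: "s \<in> S'" and t: "t \<in> T" "t' \<in> T" "t \<noteq> t'"
    and C: "set (C1 @ C2) = R" "distinct (C1 @ C2)"
begin

lemma small_simps:
  "s \<in> S" "s \<noteq> n" "s \<noteq> 0" "s \<notin> R" "s \<notin> T" "t \<notin> R" "t' \<notin> R" "s \<noteq> t" "s \<noteq> t'" "t \<noteq> s" "t' \<noteq> s" "t' \<noteq> t"
  "s \<notin> set C1" "s \<notin> set C2" "t \<notin> set C1" "t \<notin> set C2" "t' \<notin> set C1" "t' \<notin> set C2"
  "set C1 \<subseteq> R" "set C2 \<subseteq> R" "distinct C1" "distinct C2" "set C1 \<inter> set C2 = {}"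
  "set C1 \<subseteq> R \<union> S' \<union> T" "set C2 \<subseteq> R \<union> S' \<union> T"
proof -
  show C': "set C1 \<subseteq> R" "set C2 \<subseteq> R" "distinct C1" "distinct C2" "set C1 \<inter> set C2 = {}"
    using C by auto
  then show "set C1 \<subseteq> R \<union> S' \<union> T" "set C2 \<subseteq> R \<union> S' \<union> T" by blast+
  show s': "s \<in> S" "s \<noteq> n" "s \<noteq> 0" "s \<notin> R" "s \<notin> T" using memS[OF s] by simp_all
  show t': "t \<notin> R" "t' \<notin> R" using memT[OF t(1)] memT[OF t(2)] by simp_all
  show "s \<noteq> t" "s \<noteq> t'" "t \<noteq> s" "t' \<noteq> s" using s'(5) t(1,2) by blast+
  show "t' \<noteq> t" using t(3) by simp
  show "s \<notin> set C1" "s \<notin> set C2" "t \<notin> set C1" "t \<notin> set C2" "t' \<notin> set C1" "t' \<notin> set C2"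
    using C'(1,2) s'(4) t' by blast+
qed

lemma small_length: "card R = length C1 + length C2" "b = card R + 1"
proof -
  show "card R = length C1 + length C2" using C distinct_card[of "C1 @ C2"] by simp
  have "(p + card R) div 2 = card R + 1" using p3 by simp
  then show "b = card R + 1" by (simp only: b_def)
qed

lemmas small_tight = small_simps small_length t pcost_w_simps ends mem0

text \<open>A tight path now has at most one inner node of S, so instead of exchanges inside S',
  nodes are moved along R; cutting the list of R into \<open>C1\<close> and \<open>C2\<close> marks
  the place.\<close>

lemma tight_tCsC: "tight (t # C1 @ s # C2)"
  by (rule tightI) (simp add: small_simps t, (use small_simps(1-3,24,25) t(1,2) in auto)[1], simp add: p3 small_length, simp add: small_tight)

lemma tight_CstC: "tight (C1 @ [s, t] @ C2)"
  by (rule tightI) (simp add: small_simps t, (use small_simps(1-3,24,25) t(1,2) in auto)[1], simp add: p3 small_length, simp add: small_tight)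

lemma tight_ttCC: "tight ([t', t] @ C1 @ C2)"
  by (rule tightI) (simp add: small_simps t, (use small_simps(1-3,24,25) t(1,2) in auto)[1], simp add: p3 small_length, simp add: small_tight)

lemma tight_tCtC: "tight (t # C1 @ t' # C2)"
  by (rule tightI) (simp add: small_simps t, (use small_simps(1-3,24,25) t(1,2) in auto)[1], simp add: p3 small_length, simp add: small_tight)

end

lemma tight_tCst:
  assumes "p = card R + 3" "s \<in> S'" "t \<in> T" "t' \<in> T" "t \<noteq> t'" "set C = R - {i}" "distinct C" "i \<in> R"
  shows "tight (t # C @ [s, t'])"
proof -
  have C: "set ([i] @ C) = R" "distinct ([i] @ C)" using assms(6-8) by auto
  note ss = small_simps[OF assms(1-5) C] and sl = small_length[OF assms(1-5) C]
  have len: "card R = length C + 1" using sl(1) by simp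
  show ?thesis
    by (rule tightI) (use assms(7) in \<open>simp add: ss assms(3-5)\<close>, (use ss(1-3,25) assms(3,4) in auto)[1],
        simp add: assms(1) len, simp add: ss sl(2) len assms(3,4) pcost_w_simps ends mem0)
qed

context
  fixes c :: "nat \<Rightarrow> nat \<Rightarrow> real" and \<beta> :: real and s t0 :: nat
  assumes H: "\<And>us. tight us \<Longrightarrow> pcost c (0 # us @ [n]) = \<beta>"
    and p3: "p = card R + 3" and R2: "2 \<le> card R" and S1: "S' = {s}" and T2: "2 \<le> card T"
    and t0: "t0 \<in> T"
    and nt0: "\<And>v. v \<in> S' \<union> R \<union> {n} \<Longrightarrow> c t0 v = 0"
    and nTn: "\<And>t. t \<in> T \<Longrightarrow> c t n = 0"
    and n0: "c 0 s = 0" "c 0 t0 = c s t0"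
begin

lemma sS: "s \<in> S'" using S1 by simp

lemma other_T1: obtains t' where "t' \<in> T" "t' \<noteq> t"
proof -
  obtain x y where "x \<in> T" "y \<in> T" "x \<noteq> y" by (rule two_elements[OF T2])
  then show ?thesis using that[of x] that[of y] by (cases "x = t") simp_all
qed

lemma other_R1: obtains j where "j \<in> R" "j \<noteq> i"
proof -
  obtain x y where "x \<in> R" "y \<in> R" "x \<noteq> y" by (rule two_elements[OF R2])
  then show ?thesis using that[of x] that[of y] by (cases "x = i") simp_all
qed

text \<open>\<open>t\<close> cannot stand between two inner nodes of S here. So after
  \<open>c s t\<close> the arcs from \<open>t\<close> to R are settled, and through them
  \<open>c 0 t\<close> and finally \<open>c t s\<close>.\<close>

lemma small_cost_T_aux:
  assumes "t \<in> T" "t \<noteq> t0"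
  shows "c s t = c s t0" "i \<in> R \<Longrightarrow> c t i = 0" "c 0 t = c 0 t0" "c t s = 0"
proof -
  note M = sS assms(1) t0 assms(2) and M' = sS t0 assms(1) assms(2)[symmetric]
  have z: "c t0 s = 0" "c t n = 0" "c t0 n = 0" and zR: "\<And>i. i \<in> R \<Longrightarrow> c t0 i = 0"
    using nt0 nTn assms(1) sS by blast+
  obtain C where C: "set (C @ []) = R" "distinct (C @ [])" using list_of_R[of "{}"] by auto
  have "pcost c (0 # C @ [s, x, n]) = pcost c (0 # C @ [s]) + c s x + c x n" for x
    using pcost_append[of c "0 # C" s "[x, n]"] by simp
  then show st: "c s t = c s t0"
    using H[OF tight_CstC[OF p3 M C]] H[OF tight_CstC[OF p3 M' C]] z by simp
  show R: "c t i = 0" if i: "i \<in> R" for i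
  proof -
    obtain C where "set C = R - {i}" "distinct C" using list_of_R[of "{i}"] by blast
    then have C: "set ([] @ i # C) = R" "distinct ([] @ i # C)" using i by auto
    show ?thesis
      using H[OF tight_CstC[OF p3 M C]] H[OF tight_CstC[OF p3 M' C]] st zR[OF i] by simp
  qed
  obtain i where i: "i \<in> R" by (rule other_R1)
  obtain C' where "set C' = R - {i}" "distinct C'" using list_of_R[of "{i}"] by blast
  then have C': "set ((i # C') @ []) = R" "distinct ((i # C') @ [])" using i by auto
  show 0: "c 0 t = c 0 t0"
    using H[OF tight_tCsC[OF p3 M C']] H[OF tight_tCsC[OF p3 M' C']] R[OF i] zR[OF i] by simp
  have C2: "set ([] @ C) = R" "distinct ([] @ C)" using C by auto
  show "c t s = 0"
    using H[OF tight_tCsC[OF p3 M C2]] H[OF tight_tCsC[OF p3 M' C2]] 0 z by simp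
qed

lemma small_cost_T:
  assumes "t \<in> T" "v \<in> S' \<union> R \<union> {n}"
  shows "c t v = 0"
proof (cases "t = t0")
  case True
  then show ?thesis using nt0 assms by simp
next
  case False
  have "v = s \<or> v \<in> R \<or> v = n" using assms(2) S1 by auto
  then show ?thesis
    using small_cost_T_aux(2,4)[OF assms(1) False] nTn[OF assms(1)] by (elim disjE) simp_all
qed

lemma small_cost_0T: "t \<in> T \<Longrightarrow> c 0 t = c 0 t0"
  using small_cost_T_aux(3)[of t] by (cases "t = t0") auto

lemma small_cost_ST: "t \<in> T \<Longrightarrow> c s t = c 0 t0"
  using small_cost_T_aux(1)[of t] n0(2) by (cases "t = t0") auto

lemma small_cost_TT:
  assumes "t \<in> T" "t' \<in> T" "t \<noteq> t'"
  shows "c t' t = 0"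
proof -
  obtain C where C: "set ([] @ C) = R" "distinct ([] @ C)" using list_of_R[of "{}"] by auto
  show ?thesis
    using H[OF tight_ttCC[OF p3 sS assms C]] H[OF tight_CstC[OF p3 sS assms C]]
      small_cost_0T[OF assms(2)] small_cost_ST[OF assms(1)] n0(1) by simp
qed

text \<open>Here \<open>card R >= 2\<close> enters: paths through \<open>i\<close>,
  \<open>s\<close>, \<open>j\<close> and \<open>s\<close>, \<open>i\<close>, \<open>j\<close> relate
  the arc from \<open>i\<close> to \<open>s\<close> to an arc inside R. With one node in R, the
  exceptional equation ties it to the arcs from 0 to \<open>i\<close> and from \<open>s\<close> to
  \<open>n\<close>.\<close>

lemma small_costs:
  assumes i: "i \<in> R" and j: "j \<in> R" "j \<noteq> i"
  shows "c s i = 0" "c i s = c i j" "c 0 i = 0" "c i s = c i n" "c s n = 0"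
    and "t' \<in> T \<Longrightarrow> c i t' = c i n" "c i j = c 0 t0"
proof -
  obtain t where t: "t \<in> T" "t \<noteq> t0" by (rule other_T1)
  note M = p3 sS t(1) t0 t(2)
  have t_out: "c x s = 0" "c x n = 0" "c x i = 0" "c x j = 0" if "x \<in> T" for x
    using small_cost_T[OF that] S1 i j(1) by blast+
  have t_in: "c 0 x = c 0 t0" "c s x = c 0 t0" if "x \<in> T" for x
    using small_cost_0T[OF that] small_cost_ST[OF that] .
  note simps = t_out[OF t(1)] t_in(1)[OF t(1)] t_in(2)[OF t(1)] n0(1)
  obtain C where C: "set C = R - {i, j}" "distinct C" using list_of_R[of "{i, j}"] by blast
  have Cij: "set ([] @ i # j # C) = R" "distinct ([] @ i # j # C)"
    "set ([] @ j # i # C) = R" "distinct ([] @ j # i # C)"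
    "set ([i] @ j # C) = R" "distinct ([i] @ j # C)"
    "set ((i # j # C) @ []) = R" "distinct ((i # j # C) @ [])"
    "set ((j # C @ [i]) @ []) = R" "distinct ((j # C @ [i]) @ [])"
    "set ([] @ (j # C @ [i])) = R" "distinct ([] @ (j # C @ [i]))"
    using C i j by auto
  show si: "c s i = 0"
    using H[OF tight_tCsC[OF M Cij(1,2)]] H[OF tight_CstC[OF M Cij(1,2)]] by (simp add: simps)
  have sj: "c s j = 0"
    using H[OF tight_tCsC[OF M Cij(3,4)]] H[OF tight_CstC[OF M Cij(3,4)]] by (simp add: simps)
  show ij: "c i s = c i j"
    using H[OF tight_tCsC[OF M Cij(5,6)]] H[OF tight_tCsC[OF M Cij(1,2)]] by (simp add: simps si sj)
  show "c 0 i = 0"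
    using H[OF tight_tCsC[OF M Cij(5,6)]] H[OF tight_CstC[OF M Cij(5,6)]] by (simp add: simps si sj)
  have "c 0 j = 0"
  proof -
    have C': "set ([j] @ i # C) = R" "distinct ([j] @ i # C)" using C i j by auto
    show ?thesis
      using H[OF tight_tCsC[OF M C']] H[OF tight_CstC[OF M C']] by (simp add: simps si sj)
  qed
  note simps = simps this si sj
  have split: "pcost c (j # C @ i # z # zs) = pcost c (j # C @ [i]) + pcost c (i # z # zs)" for z zs
    using pcost_append[of c "j # C" i "z # zs"] by simp
  show isn: "c i s = c i n"
    using H[OF tight_CstC[OF M Cij(9,10)]] H[OF tight_CstC[OF M Cij(11,12)]] by (simp add: simps split)
  show sn: "c s n = 0"
    using H[OF tight_tCsC[OF M Cij(9,10)]] H[OF tight_CstC[OF M Cij(11,12)]] isn by (simp add: simps split)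
  show "c i t' = c i n" if t': "t' \<in> T"
  proof -
    obtain x where x: "x \<in> T" "x \<noteq> t'" by (rule other_T1)
    show ?thesis
      using H[OF tight_tCtC[OF p3 sS x(1) t' x(2) Cij(9,10)]] H[OF tight_CstC[OF p3 sS x(1) t' x(2) Cij(11,12)]]
      by (simp add: t_out[OF x(1)] t_out[OF t'] t_in(1)[OF x(1)] t_in(2)[OF x(1)] n0(1) split)
  qed
  have C9: "set (j # C) = R - {i}" "distinct (j # C)" using C i j by auto
  have split': "pcost c (j # C @ s # z # zs) = pcost c (j # C @ [s]) + pcost c (s # z # zs)" for z zs
    using pcost_append[of c "j # C" s "z # zs"] by simp
  \<comment> \<open>Omitting \<open>i\<close> trades the arc leaving \<open>i\<close> for the arc
    from \<open>s\<close> to \<open>t0\<close>.\<close>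
  show "c i j = c 0 t0"
    using H[OF tight_tCst[OF M C9 i]] H[OF tight_tCsC[OF M Cij(7,8)]]
    by (simp add: simps sn split' t_out[OF t0] n0(2)[symmetric])
qed

lemma normalized_cost_eq1: "(u, v) \<in> arcs n \<Longrightarrow> c u v = c 0 t0 * w u v"
proof (rule eq_on_arcsI)
  show "c 0 v = c 0 t0" if "v \<in> T" for v by (rule small_cost_0T[OF that])
  have R: "\<exists>j. j \<in> R \<and> j \<noteq> i" for i using other_R1 by metis
  show "c 0 v = 0" if "v \<in> S' \<union> R" for v
    using that n0(1) S1 small_costs(3)[of v] R[of v] by auto
  show "c s' v = c 0 t0" if "s' \<in> S'" "v \<in> T" for s' v using small_cost_ST[OF that(2)] that(1) S1 by simp
  show "c s' v = 0" if "s' \<in> S'" "v \<in> S' \<union> R \<union> {n}" "s' \<noteq> v" for s' v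
  proof -
    obtain i j where ij: "i \<in> R" "j \<in> R" "j \<noteq> i" using R other_R1 by metis
    have "s' = s" "v \<in> R \<or> v = n" using that S1 by auto
    then show ?thesis using small_costs(1)[of v] R[of v] small_costs(5)[OF ij] by auto
  qed
  show "c t v = 0" if "t \<in> T" "v \<in> T \<union> S' \<union> R \<union> {n}" "t \<noteq> v" for t v
  proof (cases "v \<in> T")
    case False
    then show ?thesis using that(2) by (intro small_cost_T[OF that(1)]) simp
  qed (use small_cost_TT[OF _ that(1)] that(3) in simp)
  show "c i v = c 0 t0" if "i \<in> R" "v \<in> T \<union> S' \<union> R \<union> {n}" "i \<noteq> v" for i v
  proof -
    obtain j where j: "j \<in> R" "j \<noteq> i" by (rule other_R1)
    have i: "c i n = c 0 t0" "c i s = c 0 t0"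
      using small_costs(2,4,7)[OF that(1) j] by simp_all
    have "v \<in> T \<or> v = s \<or> v \<in> R \<or> v = n" using that(2) S1 by auto
    then show ?thesis
      using small_costs(6)[OF that(1) j, of v] small_costs(7)[OF that(1) _ that(3)[symmetric]] i
      by (elim disjE) simp_all
  qed
qed

end

end

section \<open>Return to arbitrary costs and the facet criterion\<close>

context gmc
begin

lemma affine_cost:
  assumes "s0 \<in> S'" "t0 \<in> T" and tight: "\<And>us. tight us \<Longrightarrow> pcost c0 (0 # us @ [n]) = \<beta>"
    and normalized: "\<And>c \<beta>. (\<And>us. tight us \<Longrightarrow> pcost c (0 # us @ [n]) = \<beta>) \<Longrightarrow>
      (\<And>v. v \<in> S' \<union> R \<union> {n} \<Longrightarrow> c t0 v = 0) \<Longrightarrow> (\<And>t. t \<in> T \<Longrightarrow> c t n = 0) \<Longrightarrow>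
      c 0 s0 = 0 \<Longrightarrow> c 0 t0 = c s0 t0 \<Longrightarrow> (\<And>u v. (u, v) \<in> arcs n \<Longrightarrow> c u v = c 0 t0 * w u v)"
  shows "\<exists>l m. \<forall>us. inner_path n p us \<longrightarrow> pcost c0 (0 # us @ [n]) = l * pcost w (0 # us @ [n]) + m"
proof -
  obtain c d f where c: "\<And>u v. c u v = c0 u v + (d + (f u - f v))"
    and norm: "\<And>v. v \<in> S' \<union> R \<union> {n} \<Longrightarrow> c t0 v = 0" "\<And>t. t \<in> T \<Longrightarrow> c t n = 0"
      "c 0 s0 = 0" "c 0 t0 = c s0 t0"
    using normalize[OF assms(1,2), of c0] by blast
  \<comment> \<open>Each of the \<open>p\<close> arcs adds \<open>d\<close>, and the potential
    telescopes to its values at the ends.\<close>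
  define m where "m = d * real p + (f 0 - f n)"
  have shift: "pcost c (0 # us @ [n]) = pcost c0 (0 # us @ [n]) + m" if "inner_path n p us" for us
  proof -
    have "c = (\<lambda>u v. c0 u v + (d + (f u - f v)))" using c by (intro ext)
    then have "pcost c (0 # us @ [n]) = pcost c0 (0 # us @ [n]) +
        (pcost (\<lambda>u v. d) (0 # us @ [n]) + pcost (\<lambda>u v. f u - f v) (0 # us @ [n]))"
      by (simp only: pcost_add)
    moreover have "length (us @ [n]) = p" using that by (simp add: inner_path_def)
    ultimately show ?thesis unfolding pcost_const pcost_potential m_def by simp
  qed
  have "pcost c (0 # us @ [n]) = \<beta> + m" if "tight us" for us
    using shift[OF tightD(1)[OF that]] tight[OF that] by simp
  then have arcs: "c u v = c 0 t0 * w u v" if "(u, v) \<in> arcs n" for u v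
    using normalized[of c "\<beta> + m"] norm that by blast
  have "pcost c0 (0 # us @ [n]) = c 0 t0 * pcost w (0 # us @ [n]) + (- m)" if "inner_path n p us" for us
  proof -
    have "pcost c (0 # us @ [n]) = pcost (\<lambda>u v. c 0 t0 * w u v) (0 # us @ [n])"
      using path_arcs_subset_arcs[OF is_p_path_inner[OF that]] by (intro pcost_cong arcs) blast
    then show ?thesis using shift[OF that] by (simp add: pcost_scale)
  qed
  then show ?thesis by blast
qed

lemma facet_if_ge2:
  assumes k: "p = card R + 2 * k + 1" "2 \<le> k" "k \<le> card S'" "k + 1 \<le> card T"
  shows "facet_defining (path_polytope n p) (gmc_lhs n R S T) (real b)"
proof -
  have "card S' \<ge> 2" using k by simp
  then obtain s s' where s: "s \<in> S'" "s' \<in> S'" "s \<noteq> s'" by (rule two_elements)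
  have "3 \<le> card T" using k by simp
  then obtain B where "B \<subseteq> T" "card B = 3" using obtain_subset_with_card_n[of 3 T] by blast
  then obtain t t' t'' where t: "t \<in> T" "t' \<in> T" "t'' \<in> T" "t \<noteq> t'" "t \<noteq> t''" "t' \<noteq> t''"
    by (auto simp: card_3_iff)
  have "\<exists>Z. conf k s s' t t' t'' Z"
    by (rule conf_exists[OF k]) (use s t in simp_all)
  then obtain Z where Z: "conf k s s' t t' t'' Z" by blast
  obtain C where C: "set C = R" "distinct C" using list_of_R[of "{}"] by auto
  note cs = conf_simps[OF Z C] and cl = conf_length[OF Z C]
  have tight: "tight ([t, s, s', t'] @ C @ Z)" by (rule tight_tsstCZ[OF Z C])
  \<comment> \<open>This reordering has three units of slack, at 0 to \<open>s\<close>,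
    \<open>s\<close> to \<open>s'\<close> and \<open>t\<close> to \<open>t'\<close>, so its weight
    is \<open>b - 1\<close>.\<close>
  then have inner: "inner_path n p ([s, s', t, t'] @ C @ Z)"
    using tightD(1)[OF tight] s(3) by (auto simp: inner_path_def)
  have "pcost w (0 # ([s, s', t, t'] @ C @ Z) @ [n]) = real (card R + k) - 1"
    using cl(5) by (simp add: cs cl(1) C pcost_w_simps ends mem0)
  then have "\<not> tight ([s, s', t, t'] @ C @ Z)"
    using tightD(2)[of "[s, s', t, t'] @ C @ Z"] cl(4) by auto
  then show ?thesis
  proof (rule facetI[OF inner _ tight])
    fix c \<beta> assume H: "\<And>us. tight us \<Longrightarrow> pcost c (0 # us @ [n]) = \<beta>"
    show "\<exists>l m. \<forall>us. inner_path n p us \<longrightarrow> pcost c (0 # us @ [n]) = l * pcost w (0 # us @ [n]) + m"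
    proof (rule affine_cost[OF s(1) t(1) H])
      fix c \<beta> u v
      assume "\<And>us. tight us \<Longrightarrow> pcost c (0 # us @ [n]) = \<beta>" "\<And>v. v \<in> S' \<union> R \<union> {n} \<Longrightarrow> c t v = 0"
        "\<And>t. t \<in> T \<Longrightarrow> c t n = 0" "c 0 s = 0" "c 0 t = c s t" "(u, v) \<in> arcs n"
      then show "c u v = c 0 t * w u v" by (rule normalized_cost_ge2[OF _ k s(1) t(1)])
    qed
  qed
qed

lemma facet_if_eq1:
  assumes p3: "p = card R + 3" and "2 \<le> card R" "card S' = 1" "2 \<le> card T"
  shows "facet_defining (path_polytope n p) (gmc_lhs n R S T) (real b)"
proof -
  obtain s where S: "S' = {s}" using assms(3) by (auto simp: card_1_singleton_iff)
  then have s: "s \<in> S'" by simp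
  obtain t t' where t: "t \<in> T" "t' \<in> T" "t \<noteq> t'" using assms(4) by (rule two_elements)
  obtain i j where i: "i \<in> R" "j \<in> R" "i \<noteq> j" using assms(2) by (rule two_elements)
  obtain C where "set C = R - {i}" "distinct C" using list_of_R[of "{i}"] by blast
  then have C: "set ([] @ i # C) = R" "distinct ([] @ i # C)" using i by auto
  note ss = small_simps[OF p3 s t C] and sl = small_length[OF p3 s t C]
  have tight: "tight ([] @ [s, t] @ i # C)" by (rule tight_CstC[OF p3 s t C])
  \<comment> \<open>Again three units of slack: 0 to \<open>s\<close>, \<open>s\<close> to
    \<open>i\<close>, and the last node of R to \<open>t\<close>.\<close>
  then have inner: "inner_path n p (s # i # C @ [t])"
    using tightD(1)[OF tight] by (auto simp: inner_path_def)
  have CR: "set C \<subseteq> R" "i \<notin> T" "length C + 1 = card R" using C(1) sl(1) memR[OF i(1)] by auto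
  have "pcost w (0 # (s # i # C @ [t]) @ [n]) = real (length C + 1)"
    using CR(1,2) i(1) by (simp add: ss t(1) pcost_w_simps ends mem0)
  then have "\<not> tight (s # i # C @ [t])"
    using tightD(2)[of "s # i # C @ [t]"] sl(2) CR(3) by auto
  then show ?thesis
  proof (rule facetI[OF inner _ tight])
    fix c \<beta> assume H: "\<And>us. tight us \<Longrightarrow> pcost c (0 # us @ [n]) = \<beta>"
    show "\<exists>l m. \<forall>us. inner_path n p us \<longrightarrow> pcost c (0 # us @ [n]) = l * pcost w (0 # us @ [n]) + m"
    proof (rule affine_cost[OF s t(1) H])
      fix c \<beta> u v
      assume "\<And>us. tight us \<Longrightarrow> pcost c (0 # us @ [n]) = \<beta>" "\<And>v. v \<in> S' \<union> R \<union> {n} \<Longrightarrow> c t v = 0"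
        "\<And>t. t \<in> T \<Longrightarrow> c t n = 0" "c 0 s = 0" "c 0 t = c s t" "(u, v) \<in> arcs n"
      then show "c u v = c 0 t * w u v" by (rule normalized_cost_eq1[OF _ p3 assms(2) S assms(4) t(1)])
    qed
  qed
qed

lemma facet_iff:
  "facet_defining (path_polytope n p) (gmc_lhs n R S T) (real b) \<longleftrightarrow>
    odd (p + card R) \<and> p \<le> card R + 2 * card S' + 1 \<and> p + 1 \<le> card R + 2 * card T \<and>
    (p = card R + 3 \<and> 2 \<le> card R \<and> card S' = 1 \<or> card R + 5 \<le> p)" (is "?F \<longleftrightarrow> ?odd \<and> ?S \<and> ?T \<and> ?k")
proof
  assume F: ?F
  have "?odd" "?S" "?T" "card R + 3 \<le> p"
    using facet_imp_odd[OF F] facet_imp_card_S[OF F] facet_imp_card_T[OF F] facet_imp_p_ge[OF F] .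
  moreover have "?k"
  proof (cases "p = card R + 3")
    case True
    then have "2 \<le> card R" "card S' \<le> 1" using facet_imp_card_R[OF F] facet_imp_card_S_le[OF F] by blast+
    then show ?thesis using True \<open>?S\<close> by linarith
  next
    case False
    then show ?thesis using \<open>?odd\<close> \<open>card R + 3 \<le> p\<close> by presburger
  qed
  ultimately show "?odd \<and> ?S \<and> ?T \<and> ?k" by blast
next
  assume asm: "?odd \<and> ?S \<and> ?T \<and> ?k"
  show ?F
  proof (cases "card R + 5 \<le> p")
    case True
    define k where "k = (p - card R) div 2"
    have "p = card R + 2 * k + 1" using asm True unfolding k_def by presburger
    then show ?F using asm True by (intro facet_if_ge2[of k]) linarith+
  next
    case False
    then show ?F using asm by (intro facet_if_eq1) linarith+
  qed
qed

end

theorem theorem15: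
  fixes n p :: nat and R S T :: "nat set"
  assumes "4 \<le> p" and "p \<le> n - 1"
    and "R \<union> S \<union> T = {0..n}" and "R \<inter> S = {}" and "R \<inter> T = {}" and "S \<inter> T = {}"
    and "0 \<in> S" and "n \<in> S"
  shows "valid_ineq (path_polytope n p) (gmc_lhs n R S T) (real ((p + card R) div 2)) \<and>
    (facet_defining (path_polytope n p) (gmc_lhs n R S T) (real ((p + card R) div 2)) \<longleftrightarrow>
      odd (p + card R) \<and>
      real (card (S - {n})) > (real p - real (card R)) / 2 \<and>
      real (card T) > (real p - real (card R)) / 2 \<and>
      ((p = card R + 3 \<and> card R \<ge> 2 \<and> card S = 3) \<or> p \<ge> card R + 5))"
proof -
  have "p < n" using assms(1,2) by simp
  interpret gmc n p R S T
    by (intro gmc.intro assms \<open>p < n\<close>)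
  have b: "(p + card R) div 2 = b" by (simp add: b_def)
  have "0 \<noteq> n" using p4 pn by simp
  have two: "card {0, n} = 2" using \<open>0 \<noteq> n\<close> by simp
  have "card {0, n} \<le> card S" by (rule card_mono[OF fin(2)]) (use ends in auto)
  moreover have "card S' = card S - card {0, n}" by (rule card_Diff_subset) (use ends in auto)
  moreover have "card (S - {n}) = card S - card {n}" by (rule card_Diff_subset) (use ends in auto)
  \<comment> \<open>\<open>S - {n}\<close> still counts node 0, which shifts the bound by one; with
    both ends, a single inner node means \<open>card S = 3\<close>.\<close>
  ultimately have "card (S - {n}) = card S' + 1" "card S = card S' + 2"
    unfolding two by simp_all
  then have "real (card (S - {n})) > (real p - real (card R)) / 2 \<longleftrightarrow> p \<le> card R + 2 * card S' + 1"
    and "card S = 3 \<longleftrightarrow> card S' = 1"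
    by (simp_all, linarith)
  moreover have "real (card T) > (real p - real (card R)) / 2 \<longleftrightarrow> p + 1 \<le> card R + 2 * card T"
    by (simp add: field_simps) linarith
  ultimately show ?thesis
    unfolding b using valid facet_iff by simp
qed

end
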